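(* For $n\geq 1$ let $\mathcal{C}^*(n)$ denote the set of maximal compositions of $n$. For every integer $\ell\geq 2$: \begin{itemize} \item $\mathcal{C}^*(3\ell)=\{(3^{\ell}),\,(4,3^{\ell-2},2)\}$, \item $\mathcal{C}^*(3\ell+1)=\{(3^{s},2,3^{t},2)\;:\;s\geq1,\; t\geq0,\;s+t=\ell-1\}$, \item $\mathcal{C}^*(3\ell+2)=\{(3^{\ell},2)\}$. \end{itemize} Equivalently, for $n\geq 6$, the subsets $S\subseteq\{1,\dots,n\}$ that maximize $\mathrm{P}(S;n)$ are exactly: \begin{itemize} \item if $n\equiv0\pmod{3}$: $\{3,6,9,\ldots\}\cap \{1,2,\ldots, n-1\}$ and $\{4,7,10,\ldots\}\cap \{1,2,\ldots, n-1\}$; \item if $n\equiv1\pmod{3}$: the sets $\{3,6,9,\ldots,3s,3s+2,3s+5,3s+8,\ldots\}\cap \{1,2,\ldots ,n-1\}$ with $1\leq s \leq \lfloor n/3\rfloor-1$; \item if $n\equiv2\pmod{3}$: $\{3,6,9,\ldots\}\cap \{1,2,\ldots, n-1\}$. \end{itemize}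
   Context: For $n\geq1$, $\mathcal S_n$ is the symmetric group of $[n]=\{1,\dots,n\}$; permutations are written as words $\sigma=\sigma_1\sigma_2\cdots\sigma_n$. An index $i$ is a peak of $\sigma$ if $\sigma_{i-1}<\sigma_i>\sigma_{i+1}$ (so $2\le i\le n-1$). The peak set of $\sigma$ is the set of its peaks. For a set $S$ of integers, $\mathrm{P}(S;n)$ is the number of $\sigma\in\mathcal S_n$ with peak set exactly $S$. A composition of $n$ is a finite sequence of positive integers with sum $n$ (its size). If the peak set of $\sigma\in\mathcal S_n$ is $\{i_1<\dots<i_k\}$, the peak-composition of $\sigma$ is $(c_1,\dots,c_{k+1})$ with $c_j=i_j-i_{j-1}$, where $i_0=0$, $i_{k+1}=n$. For a composition $\mathbf c$, $\mathrm{P}(\mathbf c)$ is the number of permutations (of $[\,$size of $\mathbf c]$) whose peak-composition is $\mathbf c$. A composition $\mathbf c$ is maximal if $\mathrm{P}(\mathbf b)\le \mathrm{P}(\mathbf c)$ for every composition $\mathbf b$ of the same size. Exponents denote repetition of parts, e.g. $(3^2,4)=(3,3,4)$, and $(3^0)$ contributes no parts. *)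

theory Defs
  imports "HOL-Combinatorics.Permutations"
begin

text \<open>Permutations of \<open>{1..n}\<close> are functions \<open>\<sigma>\<close> with \<open>\<sigma> permutes {1..n}\<close>; the \<open>i\<close>-th letter of
  the word of \<open>\<sigma>\<close> is \<open>\<sigma> i\<close>. Such a function is the identity outside \<open>{1..n}\<close>, so the range of
  peaks is bounded explicitly.\<close>

definition peak_set :: "nat \<Rightarrow> (nat \<Rightarrow> nat) \<Rightarrow> nat set" where
  "peak_set n \<sigma> = {i. 2 \<le> i \<and> i \<le> n - 1 \<and> \<sigma> (i - 1) < \<sigma> i \<and> \<sigma> i > \<sigma> (i + 1)}"

definition P_set :: "nat set \<Rightarrow> nat \<Rightarrow> nat" where
  "P_set S n = card {\<sigma>. \<sigma> permutes {1..n} \<and> peak_set n \<sigma> = S}"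

definition composition :: "nat \<Rightarrow> nat list \<Rightarrow> bool" where
  "composition n c \<longleftrightarrow> (\<forall>x\<in>set c. 0 < x) \<and> sum_list c = n"

text \<open>With \<open>is = [i\<^sub>1, \<dots>, i\<^sub>k]\<close>, this is the list of differences \<open>i\<^sub>j - i\<^sub>j\<^sub>-\<^sub>1\<close> for
  \<open>1 \<le> j \<le> k + 1\<close>, where \<open>i\<^sub>0 = 0\<close> and \<open>i\<^sub>k\<^sub>+\<^sub>1 = n\<close>.\<close>

definition peak_composition :: "nat \<Rightarrow> (nat \<Rightarrow> nat) \<Rightarrow> nat list" where
  "peak_composition n \<sigma> =
     (let is = sorted_list_of_set (peak_set n \<sigma>) in map2 (-) (is @ [n]) (0 # is))"

definition P_comp :: "nat list \<Rightarrow> nat" where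
  "P_comp c = card {\<sigma>. \<sigma> permutes {1..sum_list c} \<and> peak_composition (sum_list c) \<sigma> = c}"

definition maximal_composition :: "nat list \<Rightarrow> bool" where
  "maximal_composition c \<longleftrightarrow> (\<forall>b. composition (sum_list c) b \<longrightarrow> P_comp b \<le> P_comp c)"

definition maximal_compositions :: "nat \<Rightarrow> nat list set" where
  "maximal_compositions n = {c. composition n c \<and> maximal_composition c}"

definition maximal_peak_sets :: "nat \<Rightarrow> nat set set" where
  "maximal_peak_sets n = {S. S \<subseteq> {1..n} \<and> (\<forall>T. T \<subseteq> {1..n} \<longrightarrow> P_set T n \<le> P_set S n)}"

end

theory Submission
  imports Defs "HOL-Analysis.Analysis" "HOL-Combinatorics.Multiset_Permutations"
begin

text \<open>Put infinite letters at both ends of a permutation of \<open>n\<close> letters; its peak composition becomes a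
  composition \<open>w\<close> of \<open>n + 1\<close> into parts \<open>\<ge> 2\<close>. The probability of \<open>w\<close> is obtained by composing, over
  the unit interval, one explicit kernel \<open>K c\<close> for each part \<open>c\<close>, and evaluating at \<open>(1, 1)\<close>. Instead of
  integrating over the cube, we check that both sides satisfy the same product rule, which on the
  combinatorial side comes from cutting a word in two.

  Since the kernel of a part 3 has rank one, probabilities factor at every part 3. Pointwise
  inequalities between kernels show that replacing a block by another one of the same size increases the
  probability: \<open>2, 4\<close> or \<open>2, 2, 2\<close> by \<open>3, 3\<close>, \<open>4, 4\<close> by \<open>3, 2, 3\<close>, \<open>c \<ge> 5\<close> by \<open>3, c - 3\<close>, and similarly
  when the deviating parts are separated by 3's. What remains are compositions with all parts 3
  except for one 4 or at most two 2's, whose probabilities are explicit.\<close>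

section \<open>Kernels on the unit interval\<close>

text \<open>A part 3 leaves a 2 on either side of the cut, both seeing height 1, and each further 3
  in a run costs exactly the factor 1/3. Words of equal size are thus compared through what a
  deviating part costs relative to 3's. A comparison at \<open>(1, 1)\<close> alone would not
  survive embedding a block into a longer word, because the neighbours integrate over the heights at
  its ends; so domination is required at all heights in (0, 1]. This fails for \<open>[5]\<close>
  against \<open>[3, 2]\<close>, which tie at \<open>(1, 1)\<close> with value 1/3; hence a part 5
  is removed together with a neighbour, which is at hand from size 7 on. The deviations that survive
  are told apart by the size modulo 3. The ties have two sources: reversing a word keeps its
  probability, which pairs the 4 at one end with the 4 at the other, and a single 2 enclosed by 3's
  contributes the same factor wherever it stands.\<close>

definition kernel_comp :: "(real \<Rightarrow> real \<Rightarrow> real) \<Rightarrow> (real \<Rightarrow> real \<Rightarrow> real) \<Rightarrow> real \<Rightarrow> real \<Rightarrow> real" where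
  "kernel_comp A B x y = integral {0..1} (\<lambda>z. A x z * B z y)"

definition continuous_kernel :: "(real \<Rightarrow> real \<Rightarrow> real) \<Rightarrow> bool" where
  "continuous_kernel A \<longleftrightarrow> continuous_on UNIV (\<lambda>p. A (fst p) (snd p))"

lemma continuous_kernel_continuous_on:
  assumes "continuous_kernel A" "continuous_on S f" "continuous_on S g"
  shows "continuous_on S (\<lambda>t. A (f t) (g t))"
  using continuous_on_compose2[OF assms(1)[unfolded continuous_kernel_def] continuous_on_Pair[OF assms(2,3)]]
  by simp

lemma continuous_kernel_integrable:
  assumes "continuous_kernel A" "continuous_kernel B"
  shows "(\<lambda>z. A x z * B z y) integrable_on {0..1}"
  by (intro integrable_continuous_interval continuous_on_mult
    continuous_kernel_continuous_on[OF assms(1)]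
      continuous_kernel_continuous_on[OF assms(2)] continuous_intros)

lemma continuous_kernel_conv:
  assumes "continuous_kernel A" "continuous_kernel B"
  shows "continuous_kernel (kernel_comp A B)"
proof -
  have "continuous_on (UNIV \<times> cbox 0 (1::real)) (\<lambda>(p, z). A (fst p) z * B z (snd p))"
    unfolding split_def
    by (intro continuous_on_mult continuous_kernel_continuous_on[OF assms(1)]
      continuous_kernel_continuous_on[OF assms(2)] continuous_intros)
  from integral_continuous_on_param[OF this] show ?thesis
    by (simp add: continuous_kernel_def kernel_comp_def)
qed

lemma kernel_comp_assoc:
  assumes "continuous_kernel A" "continuous_kernel B" "continuous_kernel C"
  shows "kernel_comp (kernel_comp A B) C = kernel_comp A (kernel_comp B C)"
proof (intro ext)
  fix x y
  have c: "continuous_on (cbox (0::real, 0::real) (1, 1)) (\<lambda>(z, w). A x w * B w z * C z y)"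
    unfolding split_def
    by (intro continuous_on_mult continuous_kernel_continuous_on[OF assms(1)]
      continuous_kernel_continuous_on[OF assms(3)]
      continuous_kernel_continuous_on[OF assms(2)] continuous_intros)
  have "kernel_comp (kernel_comp A B) C x y
    = integral (cbox 0 1) (\<lambda>z. integral (cbox 0 1) (\<lambda>w. A x w * B w z * C z y))"
    by (simp add: kernel_comp_def)
  also have "\<dots> = integral (cbox 0 1) (\<lambda>w. integral (cbox 0 1) (\<lambda>z. A x w * B w z * C z y))"
    by (rule integral_swap_continuous[OF c])
  also have "\<dots> = kernel_comp A (kernel_comp B C) x y"
    by (simp add: kernel_comp_def mult.assoc)
  finally show "kernel_comp (kernel_comp A B) C x y = kernel_comp A (kernel_comp B C) x y" .
qed

text \<open>Identities such as \<open>K 2 z 1 = z\<close> hold only on the unit interval, so kernels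
  are rewritten under the integral and not as functions.\<close>

lemma kernel_comp_cong:
  assumes "\<And>z. 0 \<le> z \<Longrightarrow> z \<le> 1 \<Longrightarrow> A x z = A' x z" "\<And>z. 0 \<le> z \<Longrightarrow> z \<le> 1 \<Longrightarrow> B z y = B' z y"
  shows "kernel_comp A B x y = kernel_comp A' B' x y"
  unfolding kernel_comp_def by (rule integral_cong) (simp add: assms)

text \<open>Positivity is asked for only inside the interval because the kernels used here vanish at
  height 0; continuity still makes the integral positive.\<close>

lemma kernel_comp_pos:
  assumes "continuous_kernel A" "continuous_kernel B"
    and "\<And>z. 0 < z \<Longrightarrow> z < 1 \<Longrightarrow> 0 < A x z" "\<And>z. 0 < z \<Longrightarrow> z < 1 \<Longrightarrow> 0 < B z y"
  shows "0 < kernel_comp A B x y"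
proof -
  have "continuous_on {0..1} (\<lambda>z. A x z * B z y)"
    by (intro continuous_on_mult continuous_kernel_continuous_on[OF assms(1)]
      continuous_kernel_continuous_on[OF assms(2)]
        continuous_intros)
  then show ?thesis
    using integral_less_real[of 0 1 "\<lambda>_. 0" "\<lambda>z. A x z * B z y"] assms(3,4)
      by (simp add: kernel_comp_def)
qed

lemma kernel_comp_add_left:
  assumes "continuous_kernel A" "continuous_kernel A'" "continuous_kernel B"
  shows "kernel_comp (\<lambda>x z. A x z + A' x z) B x y = kernel_comp A B x y + kernel_comp A' B x y"
  unfolding kernel_comp_def distrib_right
  by (rule integral_add) (intro continuous_kernel_integrable assms)+

lemma kernel_comp_swap: "kernel_comp (\<lambda>x y. A y x) (\<lambda>x y. B y x) x y = kernel_comp B A y x"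
  unfolding kernel_comp_def by (simp add: mult.commute)

lemma continuous_kernel_swap: "continuous_kernel A \<Longrightarrow> continuous_kernel (\<lambda>x y. A y x)"
  unfolding continuous_kernel_def[of "\<lambda>x y. A y x"]
  by (erule continuous_kernel_continuous_on) (intro continuous_intros)+

lemma continuous_kernel_add: "continuous_kernel A \<Longrightarrow> continuous_kernel B \<Longrightarrow> continuous_kernel (\<lambda>x y. A x y + B x y)"
  unfolding continuous_kernel_def by (intro continuous_intros)

lemma kernel_comp_strict_left:
  assumes "continuous_kernel A" "continuous_kernel A'" "continuous_kernel B"
    and "\<And>z. 0 < z \<Longrightarrow> z < 1 \<Longrightarrow> A x z < A' x z" "\<And>z. 0 < z \<Longrightarrow> z < 1 \<Longrightarrow> 0 < B z y"
  shows "kernel_comp A B x y < kernel_comp A' B x y"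
proof -
  have "continuous_on {0..1} (\<lambda>z. A x z * B z y)"
    by (intro continuous_on_mult continuous_kernel_continuous_on[OF assms(1)]
      continuous_kernel_continuous_on[OF assms(3)]
        continuous_intros)
  moreover have "continuous_on {0..1} (\<lambda>z. A' x z * B z y)"
    by (intro continuous_on_mult continuous_kernel_continuous_on[OF assms(2)]
      continuous_kernel_continuous_on[OF assms(3)]
        continuous_intros)
  ultimately show ?thesis
    unfolding kernel_comp_def
    by (rule integral_less_real) (use assms(4,5) in \<open>auto intro: mult_strict_right_mono\<close>)
qed

lemma kernel_comp_strict_right:
  assumes "continuous_kernel A" "continuous_kernel B" "continuous_kernel B'"
    and "\<And>z. 0 < z \<Longrightarrow> z < 1 \<Longrightarrow> 0 < A x z" "\<And>z. 0 < z \<Longrightarrow> z < 1 \<Longrightarrow> B z y < B' z y"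
  shows "kernel_comp A B x y < kernel_comp A B' x y"
proof -
  have "kernel_comp (\<lambda>x y. B y x) (\<lambda>x y. A y x) y x < kernel_comp (\<lambda>x y. B' y x) (\<lambda>x y. A y x) y x"
    by (rule kernel_comp_strict_left[OF continuous_kernel_swap[OF assms(2)] continuous_kernel_swap[OF assms(3)]
          continuous_kernel_swap[OF assms(1)] assms(5) assms(4)])
  then show ?thesis by (simp only: kernel_comp_swap[of B A y x] kernel_comp_swap[of B' A y x])
qed

section \<open>The kernel of a gap between peaks\<close>

text \<open>\<open>K c x y\<close> is the probability that \<open>c - 1\<close> independent uniform letters placed between two
  peaks of heights \<open>x\<close> and \<open>y\<close> form a valley: if \<open>t\<close> is their minimum, the density is
  \<open>(x + y - 2 * t) ^ (c - 2) / fact (c - 2)\<close> on \<open>t < min x y\<close>. In particular \<open>K 2 = min\<close>, and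
  \<open>K 3 x y = x * y\<close> has rank one.\<close>

definition K :: "nat \<Rightarrow> real \<Rightarrow> real \<Rightarrow> real" where
  "K c x y = ((x + y) ^ (c - 1) - \<bar>x - y\<bar> ^ (c - 1)) / (2 * fact (c - 1))"

lemma continuous_kernel_K: "continuous_kernel (K c)"
  unfolding continuous_kernel_def K_def by (intro continuous_intros) auto

text \<open>A part 1 would mean two adjacent peaks. Its kernel 0 lets the product rule be stated for
  all positive parts, the impossible terms dropping out.\<close>

lemma K_1: "K (Suc 0) = (\<lambda>x y. 0)" by (simp add: K_def fun_eq_iff)

lemma K_commute: "K c x y = K c y x"
  by (simp add: K_def add.commute abs_minus_commute)

lemma K_pos:
  assumes "2 \<le> c" "0 < x" "0 < y" shows "0 < K c x y"
proof -
  have "\<bar>x - y\<bar> ^ (c - 1) < (x + y) ^ (c - 1)"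
    by (rule power_strict_mono) (use assms in auto)
  then show ?thesis by (simp add: K_def)
qed

lemma K_nonneg:
  assumes "0 \<le> x" "0 \<le> y" shows "0 \<le> K c x y"
proof -
  have "\<bar>x - y\<bar> ^ (c - 1) \<le> (x + y) ^ (c - 1)"
    by (rule power_mono) (use assms in auto)
  then show ?thesis by (simp add: K_def)
qed

lemma K_2: "x \<le> y \<Longrightarrow> K 2 x y = x" "y \<le> x \<Longrightarrow> K 2 x y = y"
  by (simp_all add: K_def)

lemma K_3: "K 3 x y = x * y"
  by (simp add: K_def power2_eq_square algebra_simps)

lemma K_5: "K 5 x y = x * y * (x\<^sup>2 + y\<^sup>2) / 6"
proof -
  have "\<bar>x - y\<bar> ^ 4 = (x - y) ^ 4" by (rule power_even_abs) simp
  moreover have "(5::nat) - 1 = 4" by simp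
  ultimately have "K 5 x y = ((x + y) ^ 4 - (x - y) ^ 4) / (2 * fact 4)" by (simp only: K_def)
  also have "(x + y) ^ 4 - (x - y) ^ 4 = 8 * (x * y * (x\<^sup>2 + y\<^sup>2))" by algebra
  finally show ?thesis by (simp add: fact_numeral)
qed

text \<open>With \<open>s = x + y\<close> and \<open>d = |x - y|\<close>, the difference of powers
  factors as \<open>(s + d) * (s^(m-1) - d^(m-1)) - s * d * (s^(m-2) - d^(m-2))\<close>, and
  \<open>s + d\<close> is twice the larger height, so at most 2. The \<open>m\<close> in the
  denominator comes from the factorials.\<close>

lemma K_Suc_le:
  assumes "2 \<le> m" "0 \<le> x" "x \<le> 1" "0 \<le> y" "y \<le> 1"
  shows "K (Suc m) x y \<le> 2 / m * K m x y"
proof -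
  obtain n where m: "m = Suc (Suc n)" using assms(1) by (metis add_2_eq_Suc less_eqE)
  define s d where "s = x + y" and "d = \<bar>x - y\<bar>"
  have sd: "0 \<le> d" "d \<le> s" "s + d \<le> 2" using assms by (auto simp: s_def d_def)
  have "s ^ Suc (Suc n) - d ^ Suc (Suc n) \<le> (s + d) * (s ^ Suc n - d ^ Suc n)"
    using mult_nonneg_nonneg[of "s * d" "s ^ n - d ^ n"] sd by (simp add: algebra_simps power_mono)
  also have "\<dots> \<le> 2 * (s ^ Suc n - d ^ Suc n)"
    using sd by (intro mult_right_mono) (auto simp: power_mono simp del: power_Suc)
  finally have "(s ^ Suc (Suc n) - d ^ Suc (Suc n)) / (2 * fact (Suc (Suc n)))
      \<le> 2 * (s ^ Suc n - d ^ Suc n) / (2 * fact (Suc (Suc n)))"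
    by (rule divide_right_mono) simp
  also have "\<dots> = 2 / real (Suc (Suc n)) * ((s ^ Suc n - d ^ Suc n) / (2 * fact (Suc n)))"
    by (simp only: fact_Suc of_nat_mult times_divide_times_eq mult.left_commute)
  finally show ?thesis
    by (simp only: K_def m s_def d_def diff_Suc_1)
qed

section \<open>Composition with \<open>K 2\<close> and the product rule for single parts\<close>

lemma DERIV_abs_diff:
  fixes z y :: real
  assumes "z \<noteq> y"
  shows "((\<lambda>z. \<bar>z - y\<bar>) has_real_derivative sgn (z - y)) (at z)"
proof (rule has_field_derivative_transform_within_open[of "\<lambda>w. sgn (z - y) * (w - y)"])
  show "open (if y < z then {y<..} else {..<y})" by simp
  show "((\<lambda>w. sgn (z - y) * (w - y)) has_real_derivative sgn (z - y)) (at z)"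
    by (rule derivative_eq_intros refl)+ simp
qed (use assms in \<open>auto simp: sgn_if split: if_splits\<close>)

text \<open>Since \<open>K 2\<close> is the minimum, this is integration by parts over
  \<open>z\<close>. It is also the case \<open>p = 1\<close> of the product rule, as
  \<open>x = K 2 x 1\<close>.\<close>

lemma kernel_comp_K2:
  assumes "2 \<le> b" "0 \<le> x" "x \<le> 1" "0 \<le> y" "y \<le> 1"
  shows "kernel_comp (K 2) (K b) x y = x * K (Suc b) 1 y - K (Suc (Suc b)) x y"
proof -
  obtain n where b: "b = Suc (Suc n)" using assms(1) by (metis add_2_eq_Suc less_eqE)
  \<comment> \<open>\<open>G1\<close> is an antiderivative of \<open>K b\<close> in
    \<open>z\<close>, and \<open>G2\<close> one of \<open>G1\<close>. The second power in
    \<open>G1\<close> carries the sign of \<open>z - y\<close>; at \<open>z = 1\<close> the sign is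
    harmless and \<open>G1 1 = K (Suc b) 1 y\<close>.\<close>
  define G1 where "G1 z = ((z + y) ^ Suc (Suc n) - (z - y) * \<bar>z - y\<bar> ^ Suc n)
    / (2 * fact (Suc (Suc n)))" for z
  define G2 where "G2 z = K (Suc (Suc b)) z y" for z
  have G2_eq: "G2 z = ((z + y) ^ Suc (Suc (Suc n)) - \<bar>z - y\<bar> ^ Suc (Suc (Suc n)))
    / (2 * fact (Suc (Suc (Suc n))))" for z
    by (simp add: G2_def K_def b del: power_Suc fact_Suc)
  have cont: "continuous_on S G1" "continuous_on S G2" for S
    unfolding G1_def G2_eq by (intro continuous_intros; simp)+
  have cancel_fact: "real (Suc k) * a / (2 * fact (Suc k)) = a / (2 * fact k)" for k a
  proof -
    have "real (Suc k) * a / (2 * fact (Suc k)) = (real (Suc k) * a) / (real (Suc k) * (2 * fact k))"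
      by (simp only: fact_Suc of_nat_mult mult.left_commute)
    also have "\<dots> = a / (2 * fact k)" by (rule mult_divide_mult_cancel_left) simp
    finally show ?thesis .
  qed
  have alg: "q = real (Suc n) * B \<Longrightarrow> real (Suc (Suc n)) * A - (B + q) = real (Suc (Suc n)) * (A
    - B)" for A B q
    by (simp add: algebra_simps)
  have G1': "(G1 has_real_derivative K b z y) (at z)" if "z \<noteq> y" for z
  proof -
    have dabs: "((\<lambda>z. \<bar>z - y\<bar>) has_real_derivative sgn (z - y)) (at z)"
      using that by (rule DERIV_abs_diff)
    have "((\<lambda>z. (z + y) ^ Suc (Suc n) - (z - y) * \<bar>z - y\<bar> ^ Suc n) has_real_derivative
       real (Suc (Suc n)) * (z + y) ^ Suc n - (\<bar>z - y\<bar> ^ Suc n + (z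
         - y) * (real (Suc n) * \<bar>z-y\<bar> ^ n * sgn (z - y)))) (at z)"
      by (rule derivative_eq_intros DERIV_power[OF dabs] refl)+ (simp add: algebra_simps)
    moreover have "(z - y) * (real (Suc n) * \<bar>z-y\<bar> ^ n * sgn (z - y)) = real (Suc n) * \<bar>z-y\<bar> ^ Suc n"
      using that by (cases "y < z") (auto simp: algebra_simps)
    ultimately have "((\<lambda>z. (z + y) ^ Suc (Suc n) - (z - y) * \<bar>z - y\<bar> ^ Suc n) has_real_derivative
       real (Suc (Suc n)) * ((z + y) ^ Suc n - \<bar>z - y\<bar> ^ Suc n)) (at z)"
      by (elim DERIV_cong) (rule alg)
    from DERIV_cdivide[OF this, of "2 * fact (Suc (Suc n))"] show ?thesis
      unfolding G1_def[abs_def] K_def b diff_Suc_1 by (rule DERIV_cong) (rule cancel_fact)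
  qed
  have G2': "(G2 has_real_derivative G1 z) (at z)" if "z \<noteq> y" for z
  proof -
    have dabs: "((\<lambda>z. \<bar>z - y\<bar>) has_real_derivative sgn (z - y)) (at z)"
      using that by (rule DERIV_abs_diff)
    have "((\<lambda>z. (z + y) ^ Suc (Suc (Suc n)) - \<bar>z - y\<bar> ^ Suc (Suc (Suc n))) has_real_derivative
       real (Suc (Suc (Suc n))) * (z + y) ^ Suc (Suc n)
         - real (Suc (Suc (Suc n))) * \<bar>z-y\<bar> ^ Suc (Suc n) * sgn (z - y)) (at z)"
      by (rule derivative_eq_intros DERIV_power[OF dabs] refl)+ (simp add: algebra_simps)
    moreover have "\<bar>z-y\<bar> ^ Suc (Suc n) * sgn (z - y) = (z - y) * \<bar>z-y\<bar> ^ Suc n"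
      by (auto simp: abs_sgn mult.assoc mult.left_commute)
    ultimately have "((\<lambda>z. (z + y) ^ Suc (Suc (Suc n)) - \<bar>z - y\<bar> ^ Suc (Suc (Suc n))) has_real_derivative
       real (Suc (Suc (Suc n))) * ((z + y) ^ Suc (Suc n) - (z - y) * \<bar>z - y\<bar> ^ Suc n)) (at z)"
      by (simp only: right_diff_distrib mult.assoc)
    from DERIV_cdivide[OF this, of "2 * fact (Suc (Suc (Suc n)))"] show ?thesis
      unfolding G2_eq[abs_def] G1_def by (rule DERIV_cong) (rule cancel_fact)
  qed
  have "((\<lambda>z. K 2 x z * K b z y) has_integral (x * G1 x - G2 x) - (0 * G1 0 - G2 0)) {0..x}"
  proof (rule fundamental_theorem_of_calculus_interior_strong[of "{y}"])
    fix z assume "z \<in> {0<..<x} - {y}"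
    then have "((\<lambda>z. z * G1 z - G2 z) has_real_derivative K 2 x z * K b z y) (at z)"
      by (intro DERIV_cong[OF DERIV_diff[OF DERIV_mult[OF DERIV_ident G1'] G2']]) (auto simp: K_2)
    then show "((\<lambda>z. z * G1 z - G2 z) has_vector_derivative K 2 x z * K b z y) (at z)"
      by (simp add: has_real_derivative_iff_has_vector_derivative)
  qed (use assms in \<open>(intro continuous_intros cont | simp)+\<close>)
  moreover have "((\<lambda>z. K 2 x z * K b z y) has_integral x * G1 1 - x * G1 x) {x..1}"
  proof (rule fundamental_theorem_of_calculus_interior_strong[of "{y}"])
    fix z assume "z \<in> {x<..<1} - {y}"
    then have "((\<lambda>z. x * G1 z) has_real_derivative K 2 x z * K b z y) (at z)"
      by (intro DERIV_cong[OF DERIV_cmult[OF G1']]) (auto simp: K_2)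
    then show "((\<lambda>z. x * G1 z) has_vector_derivative K 2 x z * K b z y) (at z)"
      by (simp add: has_real_derivative_iff_has_vector_derivative)
  qed (use assms in \<open>(intro continuous_intros cont | simp)+\<close>)
  ultimately have "((\<lambda>z. K 2 x z * K b z y) has_integral
      ((x * G1 x - G2 x) - (0 * G1 0 - G2 0)) + (x * G1 1 - x * G1 x)) {0..1}"
    by (intro has_integral_combine[of 0 x 1]) (use assms in auto)
  moreover have "G2 0 = 0" using assms by (simp add: G2_def K_def)
  moreover have "G1 1 = K (Suc b) 1 y" using assms by (simp add: G1_def K_def b)
  ultimately show ?thesis by (simp add: kernel_comp_def integral_unique G2_def)
qed

lemma kernel_comp_K_commute: "kernel_comp (K a) (K b) x y = kernel_comp (K b) (K a) y x"
  unfolding kernel_comp_def by (rule integral_cong) (metis K_commute mult.commute)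

lemma K_rule_2:
  assumes "1 \<le> p" "0 \<le> x" "x \<le> 1" "0 \<le> y" "y \<le> 1"
  shows "kernel_comp (K 2) (K p) x y = x * K (Suc p) 1 y - K (Suc (Suc p)) x y"
proof (cases "p = 1")
  case True
  then show ?thesis
    using K_2(2)[of y 1] K_3[of x y] assms
      by (simp add: kernel_comp_def K_1 numeral_2_eq_2 numeral_3_eq_3)
next
  case False
  then show ?thesis using kernel_comp_K2[of p x y] assms by simp
qed

text \<open>Place \<open>p + q\<close> letters between peaks of heights \<open>x\<close> and
  \<open>y\<close> and cut after the \<open>p\<close>-th. Both pieces, closed off at the cut by
  height 1, are valleys exactly if the whole is a valley or its only peak is the letter just before
  or just after the cut: these are the three terms.\<close>

lemma K_rule:
  assumes "1 \<le> p" "1 \<le> q" "0 \<le> x" "x \<le> 1" "0 \<le> y" "y \<le> 1"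
  shows "K (Suc p) x 1 * K (Suc q) 1 y
    = K (Suc (p + q)) x y + kernel_comp (K p) (K (Suc q)) x y + kernel_comp (K (Suc p)) (K q) x y"
  using assms(2,1)
proof (induction q arbitrary: p rule: dec_induct)
  case base
  have "kernel_comp (K p) (K 2) x y = y * K (Suc p) x 1 - K (Suc (Suc p)) x y"
    using K_rule_2[of p y x] base assms by (simp add: kernel_comp_K_commute[of p] K_commute)
  moreover have "K 2 1 y = y" using assms by (simp add: K_2)
  ultimately show ?case
    by (simp add: K_1 kernel_comp_def numeral_2_eq_2)
next
  \<comment> \<open>The formula for \<open>K 2\<close> gives \<open>K (q + 2) 1 y\<close> as
    \<open>K (q + 1) 1 y\<close> minus a composition with \<open>K 2\<close>. Moving this
    \<open>K 2\<close> over to \<open>K p\<close> trades the pair \<open>(p, q + 1)\<close> for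
    \<open>(p + 1, q)\<close>, which is why the induction hypothesis has \<open>p\<close>
    arbitrary.\<close>
  case (step q)
  have xz: "K (Suc p) x 1 * z = K (Suc (Suc p)) x z + kernel_comp (K p) (K 2) x z"
    if "0 \<le> z" "z \<le> 1" for z
    using K_rule_2[of p z x] step.prems assms that by (simp add: kernel_comp_K_commute[of p] K_commute)
  have "K (Suc p) x 1 * kernel_comp (K 2) (K q) 1 y
    = kernel_comp (\<lambda>_ z. K (Suc p) x 1 * K 2 1 z) (K q) x y"
    by (simp add: kernel_comp_def mult.assoc)
  also have "\<dots> = kernel_comp (\<lambda>x z. K (Suc (Suc p)) x z + kernel_comp (K p) (K 2) x z) (K q) x y"
    by (rule kernel_comp_cong) (simp_all add: xz K_2)
  also have "\<dots> = kernel_comp (K (Suc (Suc p))) (K q) x y +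
    kernel_comp (K p) (kernel_comp (K 2) (K q)) x y"
    by (simp add: kernel_comp_add_left kernel_comp_assoc continuous_kernel_K continuous_kernel_conv)
  also have "kernel_comp (K p) (kernel_comp (K 2) (K q)) x y
      = kernel_comp (K p) (\<lambda>z y. z * K (Suc q) 1 y - K (Suc (Suc q)) z y) x y"
    by (rule kernel_comp_cong) (use assms step in \<open>simp_all add: K_rule_2\<close>)
  also have "\<dots> = kernel_comp (K p) (K 2) x 1 * K (Suc q) 1 y - kernel_comp (K p) (K (Suc (Suc q))) x y"
  proof -
    have "kernel_comp (K p) (\<lambda>z y. z * K (Suc q) 1 y - K (Suc (Suc q)) z y) x y
      = integral {0..1} (\<lambda>z. K p x z * K 2 z 1 * K (Suc q) 1 y - K p x z * K (Suc (Suc q)) z y)"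
      unfolding kernel_comp_def by (rule integral_cong) (simp add: K_2 algebra_simps)
    also have "\<dots> = integral {0..1} (\<lambda>z. K p x z * K 2 z 1 * K (Suc q) 1 y) -
      kernel_comp (K p) (K (Suc (Suc q))) x y"
      unfolding kernel_comp_def
      by (rule integral_diff) (intro integrable_on_mult_left continuous_kernel_integrable continuous_kernel_K)+
    finally show ?thesis by (simp add: kernel_comp_def)
  qed
  finally have 1: "K (Suc p) x 1 * kernel_comp (K 2) (K q) 1 y = kernel_comp (K (Suc (Suc p))) (K q) x y
      + (kernel_comp (K p) (K 2) x 1 * K (Suc q) 1 y - kernel_comp (K p) (K (Suc (Suc q))) x y)" .
  have 2: "kernel_comp (K 2) (K q) 1 y = K (Suc q) 1 y - K (Suc (Suc q)) 1 y"
    using K_rule_2[of q 1 y] step assms by simp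
  have 3: "kernel_comp (K p) (K 2) x 1 = K (Suc p) x 1 - K (Suc (Suc p)) x 1"
    using xz[of 1] by simp
  have 4: "K (Suc (Suc p)) x 1 * K (Suc q) 1 y = K (Suc (Suc (p + q))) x y
      + kernel_comp (K (Suc p)) (K (Suc q)) x y + kernel_comp (K (Suc (Suc p))) (K q) x y"
    using step.IH[of "Suc p"] by simp
  have 5: "K (Suc p) x 1 * K (Suc (Suc q)) 1 y
      = K (Suc p) x 1 * K (Suc q) 1 y - K (Suc p) x 1 * kernel_comp (K 2) (K q) 1 y"
    by (simp add: 2 right_diff_distrib)
  show ?case
    using 4 unfolding 5 1 3 by (simp add: left_diff_distrib)
qed

section \<open>Kernels of words\<close>

fun word_kernel :: "nat list \<Rightarrow> real \<Rightarrow> real \<Rightarrow> real" where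
  "word_kernel [] = (\<lambda>x y. 0)"
| "word_kernel [c] = K c"
| "word_kernel (c # d # cs) = kernel_comp (K c) (word_kernel (d # cs))"

lemma word_kernel_Cons: "cs \<noteq> [] \<Longrightarrow> word_kernel (c # cs) = kernel_comp (K c) (word_kernel cs)"
  by (cases cs) auto

lemma continuous_kernel_kw: "continuous_kernel (word_kernel w)"
proof (induction w rule: word_kernel.induct)
  case 1
  show ?case by (simp add: continuous_kernel_def)
qed (simp_all add: continuous_kernel_K continuous_kernel_conv)

text \<open>No continuous kernel is neutral for \<open>kernel_comp\<close>, so the empty word
  carries the dummy value 0 and both factors must be nonempty.\<close>

lemma word_kernel_append: "v \<noteq> [] \<Longrightarrow> w \<noteq> [] \<Longrightarrow> word_kernel (v @ w) =
  kernel_comp (word_kernel v) (word_kernel w)"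
  by (induction v rule: word_kernel.induct)
    (auto simp: word_kernel_Cons kernel_comp_assoc continuous_kernel_K continuous_kernel_kw)

lemma word_kernel_rev: "word_kernel (rev w) x y = word_kernel w y x"
proof (induction w arbitrary: x y rule: word_kernel.induct)
  case (3 c d cs)
  have "word_kernel (rev (c # d # cs)) x y = kernel_comp (word_kernel (rev (d # cs))) (K c) x y"
    using word_kernel_append[of "rev (d # cs)" "[c]"] by simp
  also have "\<dots> = kernel_comp (K c) (word_kernel (d # cs)) y x"
    unfolding kernel_comp_def 3 by (simp only: K_commute mult.commute)
  finally show ?case by simp
qed (simp_all add: K_commute)

lemma word_kernel_pos:
  assumes "w \<noteq> []" "\<forall>c\<in>set w. 2 \<le> c" "0 < x" "0 < y"
  shows "0 < word_kernel w x y"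
  using assms
  by (induction w arbitrary: x rule: word_kernel.induct) (auto simp: K_pos continuous_kernel_K continuous_kernel_kw intro!: kernel_comp_pos)

lemma word_kernel_part_1: "1 \<in> set w \<Longrightarrow> word_kernel w x y = 0"
  by (induction w arbitrary: x rule: word_kernel.induct) (auto simp: K_1 kernel_comp_def)

text \<open>The product rule for two parts holds for every right-hand height in the unit interval,
  so it may be integrated against the kernel of the remaining parts.\<close>

lemma word_kernel_rule:
  assumes "1 \<le> p" "1 \<le> q" "0 \<le> x" "x \<le> 1" "0 \<le> y" "y \<le> 1"
  shows "K (Suc p) x 1 * word_kernel (Suc q # cs) 1 y
    = word_kernel (Suc (p + q) # cs) x y + word_kernel (p # Suc q # cs) x y + word_kernel (Suc p # q # cs) x y"
proof (cases "cs = []")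
  case True
  then show ?thesis using K_rule[OF assms] by simp
next
  case False
  have "K (Suc p) x 1 * word_kernel (Suc q # cs) 1 y
    = kernel_comp (\<lambda>_ z. K (Suc p) x 1 * K (Suc q) 1 z) (word_kernel cs) x y"
    by (simp add: kernel_comp_def mult.assoc word_kernel_Cons False)
  also have "\<dots> = kernel_comp (\<lambda>x z. K (Suc (p + q)) x z + kernel_comp (K p) (K (Suc q)) x z +
    kernel_comp (K (Suc p)) (K q) x z)
      (word_kernel cs) x y"
    by (rule kernel_comp_cong) (use K_rule assms in simp_all)
  also have "\<dots> = word_kernel (Suc (p + q) # cs) x y + word_kernel (p # Suc q # cs) x y + word_kernel (Suc p # q # cs) x y"
    by (simp add: kernel_comp_add_left kernel_comp_assoc continuous_kernel_K
      continuous_kernel_conv continuous_kernel_add continuous_kernel_kw word_kernel_Cons False)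
  finally show ?thesis .
qed

text \<open>\<open>K 3 u z = K 2 u 1 * K 2 1 z\<close> separates the integrals on its two sides: the
  3 splits into a 2 ending the left word and a 2 starting the right one, with height 1 between
  them.\<close>

lemma word_kernel_3:
  assumes "0 \<le> x" "x \<le> 1" "0 \<le> y" "y \<le> 1"
  shows "word_kernel (v @ 3 # w) x y = word_kernel (v @ [2]) x 1 * word_kernel (2 # w) 1 y"
proof -
  have w: "word_kernel (3 # w) z y = z * word_kernel (2 # w) 1 y" if "0 \<le> z" "z \<le> 1" for z
  proof -
    \<comment> \<open>This is the product rule at \<open>p = q = 1\<close>; the two terms containing
      a part 1 vanish.\<close>
    have "K 2 z 1 * word_kernel (2 # w) 1 y
      = word_kernel (3 # w) z y + word_kernel (1 # 2 # w) z y + word_kernel (2 # 1 # w) z y"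
      using word_kernel_rule[of 1 1 z y w] that assms by (simp add: numeral_2_eq_2 numeral_3_eq_3)
    then show ?thesis using that by (simp add: K_2 word_kernel_part_1 del: word_kernel.simps)
  qed
  show ?thesis
  proof (cases "v = []")
    case True
    then show ?thesis using w[of x] assms by (simp add: K_2)
  next
    case False
    then have "word_kernel (v @ 3 # w) x y = kernel_comp (word_kernel v) (word_kernel (3 # w)) x y"
      by (simp add: word_kernel_append)
    also have "\<dots> = kernel_comp (word_kernel v) (\<lambda>z y. K 2 z 1 * word_kernel (2 # w) 1 y) x y"
      by (rule kernel_comp_cong) (simp_all add: w K_2)
    also have "\<dots> = word_kernel (v @ [2]) x 1 * word_kernel (2 # w) 1 y"
      using False by (simp add: word_kernel_append kernel_comp_def flip: mult.assoc)
    finally show ?thesis .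
  qed
qed

text \<open>Composing with positive kernels on either side preserves a strict pointwise inequality.
  Height 1 must be included, since either side may be empty and the final evaluation is at
  \<open>(1, 1)\<close>; height 0 must be excluded, as everything vanishes there.\<close>

lemma word_kernel_strict_mono:
  assumes "w \<noteq> []" "w' \<noteq> []" "\<forall>c\<in>set a. 2 \<le> c" "\<forall>c\<in>set b. 2 \<le> c"
    and lt: "\<And>x y. 0 < x \<Longrightarrow> x \<le> 1 \<Longrightarrow> 0 < y \<Longrightarrow> y \<le> 1 \<Longrightarrow> word_kernel w x y < word_kernel w' x y"
    and "0 < x" "x \<le> 1" "0 < y" "y \<le> 1"
  shows "word_kernel (a @ w @ b) x y < word_kernel (a @ w' @ b) x y"
proof -
  have r: "word_kernel (w @ b) x y < word_kernel (w' @ b) x y" if "0 < x" "x \<le> 1" for x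
  proof (cases "b = []")
    case False
    then show ?thesis
      using assms that
        by (auto simp: word_kernel_append continuous_kernel_kw intro!: kernel_comp_strict_left lt word_kernel_pos)
  qed (use assms that in simp)
  show ?thesis
  proof (cases "a = []")
    case False
    then show ?thesis
      using assms
      by (auto simp: word_kernel_append[of a] continuous_kernel_kw intro!: kernel_comp_strict_right r word_kernel_pos)
  qed (use assms r in simp)
qed

section \<open>Replacing blocks\<close>

lemma kernel_comp_diff_right:
  assumes "continuous_kernel A" "continuous_kernel B" "continuous_kernel B'"
  shows "kernel_comp A (\<lambda>z y. B z y - B' z y) x y = kernel_comp A B x y - kernel_comp A B' x y"
  unfolding kernel_comp_def right_diff_distrib
  by (rule integral_diff) (intro continuous_kernel_integrable assms)+

section \<open>Short words as polynomials, and runs of 3's\<close>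

lemma K_1_left:
  assumes "0 \<le> y" "y \<le> 1"
  shows "K 4 1 y = y / 2 + y ^ 3 / 6"
    and "K 5 1 y = y / 6 + y ^ 3 / 6"
    and "K 6 1 y = y / 24 + y ^ 3 / 12 + y ^ 5 / 120"
    and "K 7 1 y = y / 120 + y ^ 3 / 36 + y ^ 5 / 120"
proof -
  have K: "K (Suc m) 1 y = ((1 + y) ^ m - (1 - y) ^ m) / (2 * fact m)" for m
    using assms by (simp add: K_def)
  have "(1 + y) ^ 3 - (1 - y) ^ 3 = 6 * y + 2 * y ^ 3" by algebra
  then show "K 4 1 y = y / 2 + y ^ 3 / 6" using K[of 3] by (simp add: fact_numeral)
  have "(1 + y) ^ 4 - (1 - y) ^ 4 = 8 * y + 8 * y ^ 3" by algebra
  then show "K 5 1 y = y / 6 + y ^ 3 / 6" using K[of 4] by (simp add: fact_numeral)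
  have "(1 + y) ^ 5 - (1 - y) ^ 5 = 10 * y + 20 * y ^ 3 + 2 * y ^ 5" by algebra
  then show "K 6 1 y = y / 24 + y ^ 3 / 12 + y ^ 5 / 120" using K[of 5] by (simp add: fact_numeral)
  have "(1 + y) ^ 6 - (1 - y) ^ 6 = 12 * y + 40 * y ^ 3 + 12 * y ^ 5" by algebra
  then show "K 7 1 y = y / 120 + y ^ 3 / 36 + y ^ 5 / 120" using K[of 6] by (simp add: fact_numeral)
qed

lemma word_kernel_2_c:
  assumes "1 \<le> c" "0 \<le> x" "x \<le> 1" "0 \<le> y" "y \<le> 1"
  shows "word_kernel [2, c] x y = x * K (Suc c) 1 y - K (Suc (Suc c)) x y"
  using K_rule_2[OF assms] by simp

lemma word_kernel_22:
  assumes "0 \<le> x" "x \<le> 1"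
  shows "word_kernel [2, 2] x 1 = x / 2 - x ^ 3 / 6" "word_kernel [2, 2] 1 x = x / 2 - x ^ 3 / 6"
  using word_kernel_2_c[of 2 x 1] word_kernel_2_c[of 2 1 x] K_1_left[of x] assms
  by (simp_all add: K_3 K_commute[of 4 x] K_commute[of 3 x])

lemma word_kernel_24:
  assumes "0 \<le> y" "y \<le> 1"
  shows "word_kernel [2, 4] 1 y = y / 8 + y ^ 3 / 12 - y ^ 5 / 120"
  using word_kernel_2_c[of 4 1 y] K_1_left[of y] assms by simp

lemma word_kernel_222:
  assumes "0 \<le> x" "x \<le> 1" "0 \<le> y" "y \<le> 1"
  shows "word_kernel [2, 2, 2] x y = x * y / 3 - K 5 x y + K 6 x y"
proof -
  have "word_kernel [2, 2, 2] x y = kernel_comp (K 2) (kernel_comp (K 2) (K 2)) x y" by simp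
  also have "\<dots> = kernel_comp (K 2) (\<lambda>z y. K 3 z y - K 4 z y) x y"
    by (rule kernel_comp_cong) (use word_kernel_2_c[of 2] assms in \<open>simp_all add: K_3\<close>)
  also have "\<dots> = word_kernel [2, 3] x y - word_kernel [2, 4] x y"
    by (simp add: kernel_comp_diff_right continuous_kernel_K)
  also have "\<dots> = x * y / 3 - K 5 x y + K 6 x y"
    using word_kernel_2_c[of 3 x y] word_kernel_2_c[of 4 x y] K_1_left[of y] assms
      by (simp add: field_simps)
  finally show ?thesis .
qed

text \<open>Between two consecutive 3's of a run only \<open>[2, 2]\<close> with height 1 at both
  ends remains, worth 1/2 - 1/6 = 1/3.\<close>

lemma word_kernel_2_threes:
  assumes "0 \<le> y" "y \<le> 1"
  shows "word_kernel (2 # replicate j 3 @ w) 1 y = word_kernel (2 # w) 1 y / 3 ^ j"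
proof (induction j)
  case (Suc j)
  have "word_kernel (2 # replicate (Suc j) 3 @ w) 1 y
    = word_kernel [2, 2] 1 1 * word_kernel (2 # replicate j 3 @ w) 1 y"
    using word_kernel_3[of 1 y "[2]" "replicate j 3 @ w"] assms by simp
  also have "word_kernel [2, 2] 1 1 = 1 / 3" using word_kernel_22(1)[of 1] by simp
  finally show ?case by (simp add: Suc del: word_kernel.simps)
qed simp

lemma word_kernel_threes:
  assumes "0 \<le> x" "x \<le> 1" "0 \<le> y" "y \<le> 1"
  shows "word_kernel (v @ replicate (Suc k) 3 @ w) x y
    = word_kernel (v @ [2]) x 1 * word_kernel (2 # w) 1 y / 3 ^ k"
  using word_kernel_3[of x y v "replicate k 3 @ w"] word_kernel_2_threes[of y k w] assms by simp

text \<open>All heights are quantified, not only \<open>(1, 1)\<close>, so that the block can be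
  exchanged inside any word; strictness excludes the dominated block from every optimum.\<close>

definition dominated :: "nat list \<Rightarrow> nat list \<Rightarrow> bool" where
  "dominated w w' \<longleftrightarrow> (\<forall>x y. 0 < x \<longrightarrow> x \<le> 1 \<longrightarrow> 0 < y \<longrightarrow> y \<le> 1 \<longrightarrow> word_kernel w x y < word_kernel w' x y)"

lemma dominated_rev: "dominated w w' \<Longrightarrow> dominated (rev w) (rev w')"
  by (simp add: dominated_def word_kernel_rev)

text \<open>The word \<open>[3, 3]\<close> has kernel \<open>x * y / 3\<close>, and
  \<open>x * K 5 1 y\<close> already stays below it because \<open>y ^ 3\<close> is at most
  \<open>y\<close>; the subtracted \<open>K 6\<close> makes the inequality strict.\<close>

lemma dominated_24: "dominated [2, 4] [3, 3]"
  unfolding dominated_def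
proof (intro allI impI)
  fix x y :: real assume xy: "0 < x" "x \<le> 1" "0 < y" "y \<le> 1"
  have 33: "word_kernel [3, 3] x y = x * y / 3"
    using word_kernel_threes[of x y "[]" 1 "[]"] xy by (simp add: K_2)
  have "y ^ 3 \<le> y" using power_decreasing[of 1 3 y] xy by simp
  then have "K 5 1 y \<le> y / 3" using K_1_left[of y] xy by simp
  then have "x * K 5 1 y \<le> x * y / 3" using mult_left_mono[of _ _ x] xy by fastforce
  moreover have "word_kernel [2, 4] x y = x * K 5 1 y - K 6 x y"
    using word_kernel_2_c[of 4 x y] xy by simp
  moreover have "0 < K 6 x y" using xy by (simp add: K_pos)
  ultimately show "word_kernel [2, 4] x y < word_kernel [3, 3] x y" using 33 by linarith
qed

text \<open>The difference of the two kernels is \<open>K 5 - K 6\<close>, positive since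
  \<open>K 6\<close> is at most 2/5 of \<open>K 5\<close>.\<close>

lemma dominated_222: "dominated [2, 2, 2] [3, 3]"
  unfolding dominated_def
proof (intro allI impI)
  fix x y :: real assume xy: "0 < x" "x \<le> 1" "0 < y" "y \<le> 1"
  have 33: "word_kernel [3, 3] x y = x * y / 3"
    using word_kernel_threes[of x y "[]" 1 "[]"] xy by (simp add: K_2)
  show "word_kernel [2, 2, 2] x y < word_kernel [3, 3] x y"
    using K_Suc_le[of 5 x y] K_pos[of 5 x y] xy unfolding 33
      by (simp add: word_kernel_222 del: word_kernel.simps)
qed

text \<open>The product rule at \<open>p = 3\<close>, \<open>q = 4\<close> expresses
  \<open>[4, 4]\<close> through a product minus \<open>[3, 5]\<close> and \<open>K 8\<close>. After
  the bound 2/3 on \<open>K 4 x 1\<close>, what is left matches 2/15 exactly at \<open>y = 1\<close>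
  (7/90 + 1/18), so strictness rests on the discarded \<open>K 8\<close>.\<close>

lemma dominated_44: "dominated [4, 4] [3, 2, 3]"
  unfolding dominated_def
proof (intro allI impI)
  fix x y :: real assume xy: "0 < x" "x \<le> 1" "0 < y" "y \<le> 1"
  have "word_kernel [3, 2, 3] x y = x * (word_kernel [2, 2, 2] 1 1 * y)"
    using word_kernel_3[of x y "[]" "[2, 3]"] word_kernel_3[of 1 y "[2, 2]" "[]"] xy by (simp add: K_2)
  also have "word_kernel [2, 2, 2] 1 1 = 2 / 15"
    by (simp add: word_kernel_222 K_1_left del: word_kernel.simps)
  finally have r: "word_kernel [3, 2, 3] x y = 2 / 15 * (x * y)" by simp
  have "K 4 x 1 * K 5 1 y = K 8 x y + word_kernel [3, 5] x y + word_kernel [4, 4] x y"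
    using K_rule[of 3 4 x y] xy by simp
  moreover have "word_kernel [3, 5] x y = x * (K 6 1 y - K 7 1 y)"
    using word_kernel_3[of x y "[]" "[5]"] word_kernel_2_c[of 5 1 y] xy by (simp add: K_2)
  moreover have "0 < K 8 x y" using xy by (simp add: K_pos)
  ultimately have l: "word_kernel [4, 4] x y < K 4 x 1 * K 5 1 y - x * (K 6 1 y - K 7 1 y)" by simp
  have "x ^ 3 \<le> x" using power_decreasing[of 1 3 x] xy by simp
  then have "K 4 x 1 \<le> 2 / 3 * x" using K_1_left[of x] xy by (simp add: K_commute)
  then have "K 4 x 1 * K 5 1 y \<le> 2 / 3 * x * K 5 1 y"
    by (rule mult_right_mono) (use xy in \<open>simp add: K_nonneg\<close>)
  then have "word_kernel [4, 4] x y < x * (2 / 3 * K 5 1 y - (K 6 1 y - K 7 1 y))"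
    using l by (simp add: algebra_simps)
  also have "2 / 3 * K 5 1 y - (K 6 1 y - K 7 1 y) = 7 / 90 * y + y ^ 3 / 18"
    using xy by (simp add: K_1_left field_simps)
  also have "x * \<dots> \<le> x * (2 / 15 * y)"
    using power_decreasing[of 1 3 y] xy by (intro mult_left_mono) simp_all
  finally show "word_kernel [4, 4] x y < word_kernel [3, 2, 3] x y" unfolding r
    by (simp add: algebra_simps)
qed

text \<open>With \<open>m = c - 2\<close>, positivity of \<open>[2, m]\<close> bounds
  \<open>K c\<close> by \<open>x * K (Suc m) 1 y\<close>, and it remains to see that
  \<open>K (Suc m) 1 y\<close> is at most half of \<open>K m 1 y\<close>. The factor
  \<open>2 / m\<close> achieves this from \<open>m = 4\<close> on, which is where 6 comes
  from.\<close>

lemma dominated_ge_6: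
  assumes "6 \<le> c" shows "dominated [c] [3, c - 3]"
  unfolding dominated_def
proof (intro allI impI)
  fix x y :: real assume xy: "0 < x" "x \<le> 1" "0 < y" "y \<le> 1"
  define m where "m = c - 2"
  have m: "c = Suc (Suc m)" "4 \<le> m" "c - 3 = m - 1" using assms by (auto simp: m_def)
  have r: "word_kernel [3, c - 3] x y = x * (K m 1 y - K (Suc m) 1 y)"
    using word_kernel_3[of x y "[]" "[m - 1]"] word_kernel_2_c[of "m - 1" 1 y] xy m by (simp add: K_2)
  have "0 < word_kernel [2, m] x y" by (rule word_kernel_pos) (use xy m in auto)
  then have l: "K c x y < x * K (Suc m) 1 y"
    using word_kernel_2_c[of m x y] m xy by simp
  have "K (Suc m) 1 y \<le> 2 / m * K m 1 y" using K_Suc_le[of m 1 y] m xy by simp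
  also have "\<dots> \<le> 1 / 2 * K m 1 y"
    using m xy by (intro mult_right_mono K_nonneg) (simp_all add: field_simps)
  finally have "x * K (Suc m) 1 y \<le> x * (K m 1 y - K (Suc m) 1 y)"
    using xy by (intro mult_left_mono) simp_all
  then show "word_kernel [c] x y < word_kernel [3, c - 3] x y" using l r by simp
qed

text \<open>\<open>K 5\<close> and \<open>[3, 2]\<close> agree at \<open>(1, 1)\<close>, so
  \<open>[5]\<close> alone is not dominated. The neighbour \<open>d\<close> integrates over heights
  \<open>z < 1\<close>, where the inequality is strict.\<close>

lemma dominated_5:
  assumes "2 \<le> d" shows "dominated [5, d] [3, 2, d]"
  unfolding dominated_def
proof (intro allI impI)
  fix x y :: real assume xy: "0 < x" "x \<le> 1" "0 < y" "y \<le> 1"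
  have "kernel_comp (K 5) (K d) x y < kernel_comp (word_kernel [3, 2]) (K d) x y"
  proof (rule kernel_comp_strict_left[OF continuous_kernel_K continuous_kernel_kw continuous_kernel_K])
    fix z :: real assume z: "0 < z" "z < 1"
    have r: "word_kernel [3, 2] x z = x * (z / 2 - z ^ 3 / 6)"
      using word_kernel_3[of x z "[]" "[2]"] word_kernel_22(2)[of z] xy z by (simp add: K_2)
    have "x\<^sup>2 \<le> 1" "z\<^sup>2 < 1" using xy z by (auto simp: power_le_one power_less_one_iff)
    then have "x * z * ((x\<^sup>2 + z\<^sup>2) / 6) < x * z * (1 / 2 - z\<^sup>2 / 6)"
      using xy z by (intro mult_strict_left_mono) simp_all
    then show "K 5 x z < word_kernel [3, 2] x z"
      unfolding r by (simp add: K_5 algebra_simps power2_eq_square power3_eq_cube)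
    show "0 < K d z y" using assms xy z by (simp add: K_pos)
  qed
  then show "word_kernel [5, d] x y < word_kernel [3, 2, d] x y"
    using word_kernel_append[of "[3, 2]" "[d]"] by simp
qed

lemma word_kernel_22_le: "0 \<le> x \<Longrightarrow> x \<le> 1 \<Longrightarrow> word_kernel [2, 2] x 1 \<le> x / 2"
  by (simp add: word_kernel_22 del: word_kernel.simps)

lemma word_kernel_22_le': "0 \<le> x \<Longrightarrow> x \<le> 1 \<Longrightarrow> word_kernel [2, 2] 1 x \<le> x / 2"
  by (simp add: word_kernel_22 del: word_kernel.simps)

text \<open>The bound is attained at \<open>y = 1\<close>. The square \<open>(y^2 - 1)^2\<close>
  eliminates \<open>y ^ 5\<close> in favour of lower powers, then \<open>y ^ 3\<close> is at most
  \<open>y\<close>.\<close>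

lemma word_kernel_24_le: 
  assumes "0 \<le> y" "y \<le> 1" shows "word_kernel [2, 4] 1 y \<le> y / 5"
proof -
  have "0 \<le> y * (y\<^sup>2 - 1)\<^sup>2" "y ^ 3 \<le> y"
    using power_decreasing[of 1 3 y] assms by simp_all
  then show ?thesis
    unfolding word_kernel_24[OF assms]
      by (simp add: algebra_simps power2_eq_square power3_eq_cube eval_nat_numeral)
qed

lemma word_kernel_42_le:
  assumes "0 \<le> y" "y \<le> 1" shows "word_kernel [4, 2] y 1 \<le> y / 5"
  using word_kernel_24_le[OF assms] word_kernel_rev[of "[2, 4]" y 1] by (simp del: word_kernel.simps)

text \<open>The run of 3's factors the word, and the two ends contribute at most 1/2 * 1/5 = 1/10,
  against the 1/9 of the two extra 3's.\<close>

lemma dominated_2_threes_4: "dominated (2 # replicate (Suc k) 3 @ [4]) (replicate (k + 3) 3)"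
  unfolding dominated_def
proof (intro allI impI)
  fix x y :: real assume xy: "0 < x" "x \<le> 1" "0 < y" "y \<le> 1"
  have "word_kernel (2 # replicate (Suc k) 3 @ [4]) x y
    = word_kernel [2, 2] x 1 * word_kernel [2, 4] 1 y / 3 ^ k"
    using word_kernel_threes[of x y "[2]" k "[4]"] xy by simp
  also have "\<dots> \<le> (x / 2) * (y / 5) / 3 ^ k"
    using xy by (intro divide_right_mono mult_mono word_kernel_22_le word_kernel_24_le less_imp_le[OF word_kernel_pos]) auto
  also have "\<dots> < x * y / 3 ^ (k + 2)" using xy by (simp add: field_simps)
  also have "\<dots> = word_kernel (replicate (k + 3) 3) x y"
    using word_kernel_threes[of x y "[]" "k + 2" "[]"] xy by (simp add: K_2 numeral_3_eq_3)
  finally show "word_kernel (2 # replicate (Suc k) 3 @ [4]) x y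
    < word_kernel (replicate (k + 3) 3) x y" .
qed

text \<open>The two ends contribute at most 1/25; the replacement has the factor 2/15 of an enclosed
  2 and one further 1/3, that is 2/45.\<close>

lemma dominated_4_threes_4: "dominated (4 # replicate (Suc k) 3 @ [4]) (3 # 2 # replicate (k + 2) 3)"
  unfolding dominated_def
proof (intro allI impI)
  fix x y :: real assume xy: "0 < x" "x \<le> 1" "0 < y" "y \<le> 1"
  have "word_kernel (4 # replicate (Suc k) 3 @ [4]) x y
    = word_kernel [4, 2] x 1 * word_kernel [2, 4] 1 y / 3 ^ k"
    using word_kernel_threes[of x y "[4]" k "[4]"] xy by simp
  also have "\<dots> \<le> (x / 5) * (y / 5) / 3 ^ k"
    using xy by (intro divide_right_mono mult_mono word_kernel_42_le word_kernel_24_le less_imp_le[OF word_kernel_pos]) auto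
  also have "\<dots> < x * (2 / 15 * y / 3 ^ (k + 1))" using xy by (simp add: field_simps)
  also have "\<dots> = word_kernel (3 # 2 # replicate (k + 2) 3) x y"
    using word_kernel_3[of x y "[]" "2 # replicate (k + 2) 3"]
      word_kernel_threes[of 1 y "[2, 2]" "k + 1" "[]"] xy
      word_kernel_222[of 1 1] by (simp add: K_2 K_1_left del: word_kernel.simps(3))
  finally show "word_kernel (4 # replicate (Suc k) 3 @ [4]) x y
    < word_kernel (3 # 2 # replicate (k + 2) 3) x y" .
qed

text \<open>5/24 = 1/3 - 1/6 + 1/24 is the linear coefficient of the polynomial; the higher terms
  add up to something nonpositive.\<close>

lemma word_kernel_222_le:
  assumes "0 \<le> x" "x \<le> 1" shows "word_kernel [2, 2, 2] x 1 \<le> 5 / 24 * x"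
proof -
  have "x ^ 5 \<le> x ^ 3" "0 \<le> x ^ 3" using power_decreasing[of 3 5 x] assms by simp_all
  moreover have "word_kernel [2, 2, 2] x 1 = x / 3 - K 5 1 x + K 6 1 x"
    using word_kernel_222[of x 1] assms by (simp add: K_commute[of _ x] del: word_kernel.simps)
  ultimately show ?thesis using K_1_left(2,3)[OF assms] by linarith
qed

text \<open>If the second run is nonempty, the word factors there and the pieces give at most 5/24 *
  1/2 = 5/48, below 1/9. If only the first run is nonempty, reversal applies; without any 3 this is
  \<open>[2, 2, 2]\<close>.\<close>

lemma dominated_2_2_2:
  "dominated (2 # replicate i 3 @ 2 # replicate j 3 @ [2]) (replicate (i + j + 2) 3)"
proof -
  have main: "dominated (2 # replicate i 3 @ 2 # replicate (Suc j) 3 @ [2]) (replicate (i + j + 3) 3)" for i j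
    unfolding dominated_def
  proof (intro allI impI)
    fix x y :: real assume xy: "0 < x" "x \<le> 1" "0 < y" "y \<le> 1"
    have 222: "word_kernel [2, 2, 2] 1 1 = 2 / 15"
      by (simp add: word_kernel_222 K_1_left del: word_kernel.simps)
    have i: "word_kernel (2 # replicate i 3 @ [2, 2]) x 1 \<le> 5 / 24 * x / 3 ^ i"
    proof (cases i)
      case 0
      then show ?thesis using word_kernel_222_le[of x] xy by (simp del: word_kernel.simps)
    next
      case (Suc k)
      have "word_kernel (2 # replicate i 3 @ [2, 2]) x 1
        = word_kernel [2, 2] x 1 * word_kernel [2, 2, 2] 1 1 / 3 ^ k"
        using word_kernel_threes[of x 1 "[2]" k "[2, 2]"] xy Suc by (simp del: word_kernel.simps)
      also have "\<dots> \<le> x / 2 * (2 / 15) / 3 ^ k"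
        using xy word_kernel_22_le[of x] by (simp add: 222 divide_right_mono del: word_kernel.simps)
      also have "\<dots> \<le> 5 / 24 * x / 3 ^ i"
        using xy by (simp add: Suc field_simps)
      finally show ?thesis .
    qed
    have "word_kernel (2 # replicate i 3 @ 2 # replicate (Suc j) 3 @ [2]) x y
        = word_kernel (2 # replicate i 3 @ [2, 2]) x 1 * word_kernel [2, 2] 1 y / 3 ^ j"
      using word_kernel_threes[of x y "2 # replicate i 3 @ [2]" j "[2]"] xy
        by (simp del: word_kernel.simps)
    also have "\<dots> \<le> (5 / 24 * x / 3 ^ i) * (y / 2) / 3 ^ j"
      using xy by (intro divide_right_mono mult_mono i word_kernel_22_le' less_imp_le[OF word_kernel_pos]) auto
    also have "\<dots> < x * y / 3 ^ (i + j + 2)" using xy by (simp add: power_add field_simps)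
    also have "\<dots> = word_kernel (replicate (i + j + 3) 3) x y"
      using word_kernel_threes[of x y "[]" "i + j + 2" "[]"] xy by (simp add: K_2 numeral_3_eq_3)
    finally show "word_kernel (2 # replicate i 3 @ 2 # replicate (Suc j) 3 @ [2]) x y
      < word_kernel (replicate (i + j + 3) 3) x y" .
  qed
  show ?thesis
  proof (cases j)
    case (Suc j')
    then show ?thesis using main[of i j'] by (simp add: numeral_3_eq_3)
  next
    case j: 0
    show ?thesis
    proof (cases i)
      case 0
      then show ?thesis using dominated_222 j by (simp add: numeral_2_eq_2)
    next
      case (Suc i')
      then show ?thesis using dominated_rev[OF main[of 0 i']] j
        by (simp add: numeral_3_eq_3 replicate_append_same)
    qed
  qed
qed

section \<open>Optimal compositions\<close>

text \<open>Adding 1 to the last part of a peak composition of \<open>n\<close> amounts to placing infinite letters at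
  both ends of the word; all parts of the resulting composition of \<open>n + 1\<close> are at least 2.\<close>

definition extended_compositions :: "nat \<Rightarrow> nat list set" where
  "extended_compositions N = {w. w \<noteq> [] \<and> (\<forall>c\<in>set w. 2 \<le> c) \<and> sum_list w = N}"

definition optimal_compositions :: "nat \<Rightarrow> nat list set" where
  "optimal_compositions N
    = {w \<in> extended_compositions N. \<forall>v\<in>extended_compositions N. word_kernel v 1 1 \<le> word_kernel w 1 1}"

lemma length_le_sum_list: "\<forall>c\<in>set w. 1 \<le> c \<Longrightarrow> length w \<le> sum_list (w :: nat list)"
  by (induction w) auto

lemma finite_extended_compositions: "finite (extended_compositions N)"
proof (rule finite_subset)
  show "extended_compositions N \<subseteq> {w. set w \<subseteq> {..N} \<and> length w \<le> N}"
  proof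
    fix w assume w: "w \<in> extended_compositions N"
    then have "length w \<le> sum_list w"
      by (intro length_le_sum_list) (auto simp: extended_compositions_def)
    with w show "w \<in> {w. set w \<subseteq> {..N} \<and> length w \<le> N}"
      by (auto simp: extended_compositions_def member_le_sum_list)
  qed
qed (simp add: finite_lists_length_le)

text \<open>The later arguments only rule compositions out. That the survivors really are optimal
  needs a maximizer to exist, which finiteness provides.\<close>

lemma optimal_compositions_nonempty:
  assumes "2 \<le> N" shows "optimal_compositions N \<noteq> {}"
proof -
  have "[N] \<in> extended_compositions N" using assms by (simp add: extended_compositions_def)
  then have "Max ((\<lambda>w. word_kernel w 1 1) ` extended_compositions N) \<in> (\<lambda>w. word_kernel w 1 1) ` extended_compositions N"
    by (intro Max_in) (auto simp: finite_extended_compositions)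
  then obtain w where "w \<in> extended_compositions N"
    "word_kernel w 1 1 = Max ((\<lambda>w. word_kernel w 1 1) ` extended_compositions N)" by auto
  then have "w \<in> optimal_compositions N"
    by (auto simp: optimal_compositions_def finite_extended_compositions)
  then show ?thesis by auto
qed

lemma optimal_compositions_cong:
  assumes "w \<in> optimal_compositions N" "v \<in> extended_compositions N" "word_kernel v 1 1
    = word_kernel w 1 1"
  shows "v \<in> optimal_compositions N"
  using assms by (simp add: optimal_compositions_def)

lemma optimal_not_less:
  assumes "w \<in> optimal_compositions N" "v \<in> extended_compositions N"
    "word_kernel w 1 1 < word_kernel v 1 1"
  shows False
  using assms unfolding optimal_compositions_def by force

section \<open>Shape of an optimal composition\<close>

lemma optimal_not_dominated:
  assumes "a @ u @ b \<in> optimal_compositions N" "dominated u v" "u \<noteq> []" "v \<noteq> []"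
    "\<forall>c\<in>set v. 2 \<le> c" "sum_list u = sum_list v"
  shows False
proof (rule optimal_not_less[OF assms(1)])
  have *: "a @ u @ b \<in> extended_compositions N" using assms(1) by (simp add: optimal_compositions_def)
  then show "a @ v @ b \<in> extended_compositions N" using assms(3-)
    by (auto simp: extended_compositions_def)
  show "word_kernel (a @ u @ b) 1 1 < word_kernel (a @ v @ b) 1 1"
    by (rule word_kernel_strict_mono) (use * assms in \<open>auto simp: extended_compositions_def dominated_def\<close>)
qed

lemma optimal_le_4:
  assumes "w \<in> optimal_compositions N" "7 \<le> N" "c \<in> set w"
  shows "c \<le> 4"
proof (rule ccontr)
  assume "\<not> c \<le> 4"
  from assms(3) obtain a b where w: "w = a @ c # b" by (auto simp: in_set_conv_decomp)
  have ge: "\<forall>c\<in>set w. 2 \<le> c" and sum: "sum_list w = N" using assms(1)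
    by (auto simp: optimal_compositions_def extended_compositions_def)
  consider "6 \<le> c" | "c = 5" using \<open>\<not> c \<le> 4\<close> by linarith
  then show False
  proof cases
    case 1
    then have "2 \<le> c - 3" by linarith
    with 1 show False
      using optimal_not_dominated[of a "[c]" b N, OF _ dominated_ge_6] assms(1) w by auto
  next
    case 2
    have "a \<noteq> [] \<or> b \<noteq> []" using w sum 2 assms(2) by auto
    then show False
    proof
      assume "b \<noteq> []"
      then obtain d b' where b: "b = d # b'" by (cases b) auto
      with ge w have "2 \<le> d" by simp
      then show False
        using optimal_not_dominated[of a "[5, d]" b' N, OF _ dominated_5] assms(1) w b 2 by auto
    next
      assume "a \<noteq> []"
      then obtain d a' where a: "a = a' @ [d]" by (cases a rule: rev_cases) auto
      with ge w have d: "2 \<le> d" by simp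
      have "dominated [d, 5] [d, 2, 3]" using dominated_rev[OF dominated_5[OF d]] by simp
      then show False
        using optimal_not_dominated[of a' "[d, 5]" b N "[d, 2, 3]"] assms(1) w a 2 d by auto
    qed
  qed
qed

text \<open>Consecutive deviating parts, with only 3's between them, form a dominated block as soon
  as one of them is a 4. The pair 2, 2 is left to a comparison of exact values.\<close>

lemma optimal_pair:
  assumes w: "a @ d # replicate j 3 @ e # b \<in> optimal_compositions N" and "7 \<le> N" "d \<noteq> 3" "e \<noteq> 3"
  shows "d = 2 \<and> e = 2"
proof -
  have ge: "\<forall>c\<in>set (a @ d # replicate j 3 @ e # b). 2 \<le> c"
    using w by (auto simp: optimal_compositions_def extended_compositions_def)
  have "d \<in> {2, 4}" "e \<in> {2, 4}"
    using ge assms optimal_le_4[OF w, of d] optimal_le_4[OF w, of e] by fastforce+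
  moreover have False if dom: "dominated (d # replicate j 3 @ [e]) v" 
    and v: "v \<noteq> []" "\<forall>c\<in>set v. 2 \<le> c" "d + 3 * j + e = sum_list v" for v
    using optimal_not_dominated[of a "d # replicate j 3 @ [e]" b N v] w dom v
    by (auto simp: sum_list_replicate mult.commute)
  note step = this
  have 24: "dominated (2 # replicate j 3 @ [4]) (replicate (j + 2) 3)"
  proof (cases j)
    case (Suc k)
    then show ?thesis using dominated_2_threes_4[of k] by (simp add: numeral_3_eq_3)
  qed (use dominated_24 in \<open>simp add: numeral_2_eq_2\<close>)
  have "False" if "d = 2" "e = 4"
    using step[of "replicate (j + 2) 3"] 24 that by (auto simp: sum_list_replicate)
  moreover have "dominated (4 # replicate j 3 @ [2]) (replicate (j + 2) 3)"
    using dominated_rev[OF 24] unfolding rev_replicate by simp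
  then have "False" if "d = 4" "e = 2"
    using step[of "replicate (j + 2) 3"] that by (auto simp: sum_list_replicate)
  moreover have "False" if "d = 4" "e = 4"
  proof (cases j)
    case 0
    then show False using step[of "[3, 2, 3]"] dominated_44 that by auto
  next
    case (Suc k)
    then show False
      using step[of "3 # 2 # replicate (k + 2) 3"] dominated_4_threes_4[of k] that
      by (auto simp: sum_list_replicate)
  qed
  ultimately show ?thesis by auto
qed

lemma first_non_3:
  obtains (all) i where "w = replicate i 3"
  | (split) i d v where "w = replicate i 3 @ d # v" "d \<noteq> (3::nat)"
proof -
  have "(\<exists>i. w = replicate i 3) \<or> (\<exists>i d v. w = replicate i 3 @ d # v \<and> d \<noteq> (3::nat))"
  proof (induction w)
    case (Cons c w)
    show ?case
    proof (cases "c = 3")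
      case True
      with Cons show ?thesis by (metis append_Cons replicate_Suc)
    next
      case False
      then have "c # w = replicate 0 3 @ c # w" by simp
      with False show ?thesis by blast
    qed
  qed simp
  then show ?thesis using that by blast
qed

text \<open>By the pair condition a second deviating part forces both to be 2, and a third would be
  a 2 as well, giving a dominated block with three 2's.\<close>

lemma optimal_cases:
  assumes w: "w \<in> optimal_compositions N" and N: "7 \<le> N"
  obtains (all) i where "w = replicate i 3"
  | (two) i j where "w = replicate i 3 @ 2 # replicate j 3"
  | (four) i j where "w = replicate i 3 @ 4 # replicate j 3"
  | (two_two) i j k where "w = replicate i 3 @ 2 # replicate j 3 @ 2 # replicate k 3"
proof (cases w rule: first_non_3)
  case (split i d v)
  note 1 = this
  have d: "d \<in> {2, 4}"
    using 1 w optimal_le_4[OF w N, of d]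
      by (auto simp: optimal_compositions_def extended_compositions_def)
  show ?thesis
  proof (cases v rule: first_non_3)
    case (split j e v')
    note 2 = this
    have de: "d = 2" "e = 2" using optimal_pair[of _ d j e v' N] w N 1 2 by auto
    show ?thesis
    proof (cases v' rule: first_non_3)
      case (split k f v'')
      have "f = 2"
        using optimal_pair[of "replicate i 3 @ d # replicate j 3" e k f v'' N] w N 1 2 split by auto
      then have "replicate i 3 @ (2 # replicate j 3 @ 2 # replicate k 3 @ [2]) @ v'' \<in> optimal_compositions N"
        using w 1 2 de split by simp
      then have False
        by (rule optimal_not_dominated[OF _ dominated_2_2_2]) (auto simp: sum_list_replicate)
      then show ?thesis ..
    qed (use 1 2 de that in auto)
  qed (use 1 d that in auto)
qed (use that in auto)

section \<open>Exact values at \<open>(1, 1)\<close>\<close>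

lemma word_kernel_1_1_rev: "word_kernel (rev w) 1 1 = word_kernel w 1 1"
  by (rule word_kernel_rev)

lemma value_2_threes: "word_kernel (2 # replicate j 3) 1 1 = 1 / 3 ^ j"
  using word_kernel_2_threes[of 1 j "[]"] by (simp add: K_2)

lemma value_22_threes: "word_kernel (2 # 2 # replicate j 3) 1 1 = (if j
  = 0 then 1 / 3 else 2 / 5 / 3 ^ j)"
proof (cases j)
  case 0
  then show ?thesis using word_kernel_22[of 1] by simp
next
  case (Suc k)
  then show ?thesis
    using word_kernel_threes[of 1 1 "[2, 2]" k "[]"] word_kernel_222[of 1 1]
      by (simp add: K_2 K_1_left del: word_kernel.simps(3))
qed

lemma value_4_threes: "word_kernel (4 # replicate (Suc k) 3) 1 1 = 1 / 5 / 3 ^ k"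
proof -
  have "word_kernel [4, 2] 1 1 = 1 / 5"
    using word_kernel_24[of 1] word_kernel_1_1_rev[of "[2, 4]"] by (simp del: word_kernel.simps)
  then show ?thesis
    using word_kernel_threes[of 1 1 "[4]" k "[]"]
      by (simp add: K_2 del: word_kernel.simps(3) times_divide_eq_left divide_divide_eq_left)
qed

text \<open>The product rule with \<open>p = 1\<close> at height 1, where
  \<open>K 2 1 1 = 1\<close>. Together with reversal it strips 2's from the ends of a word.\<close>

lemma word_kernel_split_2:
  assumes "1 \<le> q"
  shows "word_kernel (2 # q # cs) 1 1 = word_kernel (Suc q # cs) 1 1
    - word_kernel (Suc (Suc q) # cs) 1 1"
proof -
  have "word_kernel (1 # Suc q # cs) 1 1 = 0" by (rule word_kernel_part_1) simp
  then show ?thesis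
    using word_kernel_rule[of 1 q 1 1 cs] K_2[of 1 1] assms
      by (simp add: numeral_2_eq_2 del: word_kernel.simps)
qed

lemma value_242: "word_kernel [2, 4, 2] 1 1 = 2 / 35"
proof -
  have K8: "K 8 1 1 = 4 / 315" by (simp add: K_def fact_numeral)
  have "word_kernel [5, 2] 1 1 = word_kernel [2, 5] 1 1" "word_kernel [6, 2] 1 1
    = word_kernel [2, 6] 1 1"
    using word_kernel_1_1_rev[of "[2, 5]"] word_kernel_1_1_rev[of "[2, 6]"]
      by (simp_all del: word_kernel.simps)
  then show ?thesis
    using word_kernel_split_2[of 4 "[2]"] word_kernel_split_2[of 5 "[]"]
      word_kernel_split_2[of 6 "[]"] K_1_left[of 1] K8
    by (simp del: word_kernel.simps(3))
qed

text \<open>The words of 2's count alternating permutations: 1, 1/3, 2/15, 17/315 are the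
  coefficients of the tangent series.\<close>

lemma value_2222: "word_kernel [2, 2, 2, 2] 1 1 = 17 / 315"
proof -
  have K8: "K 8 1 1 = 4 / 315" by (simp add: K_def fact_numeral)
  have "word_kernel [3, 2, 2] 1 1 = 2 / 15"
    using word_kernel_3[of 1 1 "[]" "[2, 2]"] word_kernel_222[of 1 1]
      by (simp add: K_2 K_1_left del: word_kernel.simps(3))
  moreover have "word_kernel [4, 2, 2] 1 1 = word_kernel [2, 2, 4] 1 1"
    using word_kernel_1_1_rev[of "[2, 2, 4]"] by (simp del: word_kernel.simps)
  moreover have "word_kernel [3, 4] 1 1 = 1 / 5"
    using word_kernel_3[of 1 1 "[]" "[4]"] word_kernel_24[of 1]
      by (simp add: K_2 del: word_kernel.simps(3))
  moreover have "word_kernel [3, 5] 1 1 = 4 / 45"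
    using word_kernel_3[of 1 1 "[]" "[5]"] word_kernel_split_2[of 5 "[]"] K_1_left[of 1]
      by (simp add: K_2 del: word_kernel.simps(3))
  moreover have "K 4 1 1 * K 5 1 1 = K 8 1 1 + word_kernel [3, 5] 1 1 + word_kernel [4, 4] 1 1"
    using K_rule[of 3 4 1 1] by simp
  ultimately show ?thesis
    using word_kernel_split_2[of 2 "[2, 2]"] word_kernel_split_2[of 2 "[4]"] K_1_left[of 1] K8
    by (simp del: word_kernel.simps(3))
qed

text \<open>The value depends on \<open>i + j\<close> only: the 3's on both sides isolate
  \<open>[2, 2, 2]\<close>. This is the origin of the family of ties.\<close>

lemma value_threes_2_threes:
  "word_kernel (replicate (Suc i) 3 @ 2 # replicate (Suc j) 3) 1 1 = 2 / 15 / 3 ^ (i + j)"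
  using word_kernel_threes[of 1 1 "[]" i "2 # replicate (Suc j) 3"] value_22_threes[of "Suc j"]
  by (simp add: K_2 power_add del: word_kernel.simps(3))

lemma value_threes_4_threes:
  "word_kernel (replicate (Suc i) 3 @ 4 # replicate (Suc j) 3) 1 1 = 2 / 35 / 3 ^ (i + j)"
  using word_kernel_threes[of 1 1 "[]" i "4 # replicate (Suc j) 3"]
    word_kernel_threes[of 1 1 "[2, 4]" j "[]"] value_242
  by (simp add: K_2 power_add del: word_kernel.simps(3))

lemma value_22_threes_le: "word_kernel (2 # 2 # replicate j 3) 1 1 \<le> 2 / 5 / 3 ^ j"
  by (simp add: value_22_threes del: word_kernel.simps)

lemma word_kernel_nonneg:
  assumes "w \<noteq> []" "\<forall>c\<in>set w. 2 \<le> c" shows "0 \<le> word_kernel w 1 1"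
  by (rule less_imp_le[OF word_kernel_pos]) (use assms in auto)

text \<open>The right-hand side is the value of a 4 at an end of equally many 3's, a word of the
  same size. Against 3/5, separated 2's reach at most 3 * (2/5)^2 = 12/25, adjacent 2's at an end
  2/5, and adjacent 2's enclosed by 3's 9 * 17/315 = 17/35.\<close>

lemma value_two_two:
  assumes "1 \<le> i + j + k"
  shows "word_kernel (replicate i 3 @ 2 # replicate j 3 @ 2 # replicate k 3) 1 1
    < 3 / 5 / 3 ^ (i + j + k)"
proof (cases j)
  case (Suc j')
  have "word_kernel (replicate i 3 @ [2, 2]) 1 1 = word_kernel (2 # 2 # replicate i 3) 1 1"
    using word_kernel_1_1_rev[of "2 # 2 # replicate i 3"] by simp
  then have i: "word_kernel (replicate i 3 @ [2, 2]) 1 1 \<le> 2 / 5 / 3 ^ i"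
    using value_22_threes_le[of i] by simp
  have "word_kernel (replicate i 3 @ 2 # replicate j 3 @ 2 # replicate k 3) 1 1
      = word_kernel (replicate i 3 @ [2, 2]) 1 1 * word_kernel (2 # 2 # replicate k 3) 1 1 / 3 ^ j'"
    using word_kernel_threes[of 1 1 "replicate i 3 @ [2]" j' "2 # replicate k 3"] Suc
      by (simp del: word_kernel.simps)
  also have "\<dots> \<le> (2 / 5 / 3 ^ i) * (2 / 5 / 3 ^ k) / 3 ^ j'"
    by (intro divide_right_mono mult_mono i value_22_threes_le word_kernel_nonneg) auto
  also have "\<dots> < 3 / 5 / 3 ^ (i + j + k)" by (simp add: Suc power_add field_simps)
  finally show ?thesis .
next
  case j: 0
  have *: "word_kernel (2 # 2 # replicate (Suc m) 3) 1 1 = 2 / 15 / 3 ^ m" for m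
    using value_22_threes[of "Suc m"] by simp
  have end_case: "word_kernel (2 # 2 # replicate (Suc m) 3) 1 1 < 3 / 5 / 3 ^ Suc m" for m
    unfolding * by (simp add: field_simps)
  show ?thesis
  proof (cases i)
    case 0
    then obtain m where "k = Suc m" using assms j by (cases k) auto
    then show ?thesis using end_case[of m] 0 j by simp
  next
    case (Suc i')
    show ?thesis
    proof (cases k)
      case 0
      then show ?thesis
        using end_case[of i'] word_kernel_1_1_rev[of "2 # 2 # replicate (Suc i') 3"] Suc j
        by (simp add: replicate_append_same)
    next
      case k: (Suc k')
      have "word_kernel (replicate i 3 @ 2 # replicate j 3 @ 2 # replicate k 3) 1 1
          = word_kernel [2, 2, 2, 2] 1 1 / 3 ^ k' / 3 ^ i'"
        using word_kernel_threes[of 1 1 "[]" i' "2 # 2 # replicate k 3"]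
          word_kernel_threes[of 1 1 "[2, 2, 2]" k' "[]"]
        by (simp add: Suc j k K_2 del: word_kernel.simps(3))
      then show ?thesis by (simp add: value_2222 Suc j k power_add field_simps del: word_kernel.simps)
    qed
  qed
qed

section \<open>Optimal compositions in each residue class\<close>

theorem optimal_compositions_mod_0:
  assumes "3 \<le> m" shows "optimal_compositions (3 * m) = {replicate m 3}"
proof -
  have "w = replicate m 3" if w: "w \<in> optimal_compositions (3 * m)" for w
  proof -
    have "sum_list w = 3 * m" using w by (simp add: optimal_compositions_def extended_compositions_def)
    \<comment> \<open>Modulo 3 the four shapes have sizes 0, 2, 1 and 1, so only the word of 3's
      remains.\<close>
    then have "sum_list w mod 3 = 0" "sum_list w = 3 * m" by simp_all
    with w assms show ?thesis
      by (cases rule: optimal_cases[OF w]) (auto simp: sum_list_replicate, presburger+)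
  qed
  moreover have "optimal_compositions (3 * m) \<noteq> {}" using assms
    by (intro optimal_compositions_nonempty) simp
  ultimately show ?thesis by blast
qed

theorem optimal_compositions_mod_1:
  assumes "2 \<le> m"
  shows "optimal_compositions (3 * m + 1) = {4 # replicate (m - 1) 3, replicate (m - 1) 3 @ [4]}"
proof -
  obtain q where q: "m = Suc (Suc q)" using assms by (metis add_2_eq_Suc less_eqE)
  have word: "4 # replicate (m - 1) 3 \<in> extended_compositions (3 * m + 1)"
    "replicate (m - 1) 3 @ [4] \<in> extended_compositions (3 * m + 1)"
    using q by (auto simp: extended_compositions_def sum_list_replicate)
  have val: "word_kernel (4 # replicate (m - 1) 3) 1 1 = 3 / 5 / 3 ^ (m - 1)"
    using value_4_threes[of q] by (simp add: q)
  have val': "word_kernel (replicate (m - 1) 3 @ [4]) 1 1 = word_kernel (4 # replicate (m - 1) 3) 1 1"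
    using word_kernel_1_1_rev[of "4 # replicate (m - 1) 3"] by simp
  have *: "w \<in> {4 # replicate (m - 1) 3, replicate (m - 1) 3 @ [4]}"
    if w: "w \<in> optimal_compositions (3 * m + 1)" for w
  proof -
    have sum: "sum_list w = 3 * m + 1" using w
      by (simp add: optimal_compositions_def extended_compositions_def)
    have not_less: "\<not> word_kernel w 1 1 < 3 / 5 / 3 ^ (m - 1)"
      using optimal_not_less[OF w word(1)] val by auto
    from assms have "7 \<le> 3 * m + 1" by simp
    from w this show ?thesis
    proof (cases rule: optimal_cases)
      case (all i)
      with sum show ?thesis by (simp add: sum_list_replicate) presburger
    next
      case (two i j)
      with sum show ?thesis by (simp add: sum_list_replicate) presburger
    next
      case (four i j)
      with sum have ij: "i + j = m - 1" by (simp add: sum_list_replicate)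
      show ?thesis
      proof (cases "i = 0 \<or> j = 0")
        case True
        with four ij show ?thesis by auto
      next
        \<comment> \<open>An enclosed 4 has 9 * 2/35 = 18/35, a 4 at an end 3/5 = 21/35.\<close>
        case False
        then obtain i' j' where "i = Suc i'" "j = Suc j'" by (metis not0_implies_Suc)
        moreover from this ij have "m - 1 = i' + j' + 2" by simp
        ultimately have "word_kernel w 1 1 < 3 / 5 / 3 ^ (m - 1)"
          using value_threes_4_threes[of i' j'] four by (simp add: field_simps power_add)
        with not_less show ?thesis by simp
      qed
    next
      case (two_two i j k)
      with sum have "i + j + k = m - 1" by (simp add: sum_list_replicate)
      with value_two_two[of i j k] two_two not_less q show ?thesis by simp
    qed
  qed
  moreover have "optimal_compositions (3 * m + 1) \<noteq> {}"
    by (intro optimal_compositions_nonempty) (use assms in simp)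
  ultimately obtain w where w: "w \<in> optimal_compositions (3 * m + 1)"
    "w \<in> {4 # replicate (m - 1) 3, replicate (m - 1) 3 @ [4]}" by blast
  then have "{4 # replicate (m - 1) 3, replicate (m - 1) 3 @ [4]} \<subseteq> optimal_compositions (3 * m + 1)"
    using optimal_compositions_cong[OF w(1)] word val' by auto
  with * show ?thesis by blast
qed

theorem optimal_compositions_mod_2:
  assumes "2 \<le> m"
  shows "optimal_compositions (3 * m + 2)
    = {replicate i 3 @ 2 # replicate j 3 | i j. 1 \<le> i \<and> 1 \<le> j \<and> i + j = m}" (is "_ = ?R")
proof -
  have word: "replicate i 3 @ 2 # replicate j 3 \<in> extended_compositions (3 * m + 2)"
    if "i + j = m" for i j
    using that by (auto simp: extended_compositions_def sum_list_replicate)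
  have val: "word_kernel (replicate i 3 @ 2 # replicate j 3) 1 1 = 6 / 5 / 3 ^ m"
    if "1 \<le> i" "1 \<le> j" "i + j = m" for i j
  proof -
    from that obtain i' j' where "i = Suc i'" "j = Suc j'" by (metis Suc_le_D One_nat_def)
    moreover from this that have "m = i' + j' + 2" by simp
    ultimately show ?thesis using value_threes_2_threes[of i' j'] by (simp add: power_add)
  qed
  have *: "w \<in> ?R" if w: "w \<in> optimal_compositions (3 * m + 2)" for w
  proof -
    have sum: "sum_list w = 3 * m + 2" using w
      by (simp add: optimal_compositions_def extended_compositions_def)
    have not_less: "\<not> word_kernel w 1 1 < 6 / 5 / 3 ^ m"
      using optimal_not_less[OF w word[of 1 "m - 1"]] val[of 1 "m - 1"] assms by auto
    from assms have "7 \<le> 3 * m + 2" by simp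
    from w this show ?thesis
    proof (cases rule: optimal_cases)
      case (all i)
      with sum show ?thesis by (simp add: sum_list_replicate) presburger
    next
      case (two i j)
      with sum have ij: "i + j = m" by (simp add: sum_list_replicate)
      \<comment> \<open>A 2 at an end is worth 1 in units of \<open>1 / 3 ^ m\<close>, an enclosed
        one 9 * 2/15 = 6/5.\<close>
      have "i \<noteq> 0"
      proof
        assume "i = 0"
        then have "word_kernel w 1 1 = 1 / 3 ^ m" using two ij value_2_threes[of m] by simp
        with not_less show False by (simp add: field_simps)
      qed
      moreover have "j \<noteq> 0"
      proof
        assume "j = 0"
        then have "word_kernel w 1 1 = 1 / 3 ^ m"
          using two ij value_2_threes[of m] word_kernel_1_1_rev[of "2 # replicate m 3"] by simp
        with not_less show False by (simp add: field_simps)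
      qed
      ultimately show ?thesis using two ij by force
    next
      case (four i j)
      with sum show ?thesis by (simp add: sum_list_replicate) presburger
    next
      case (two_two i j k)
      with sum show ?thesis by (simp add: sum_list_replicate) presburger
    qed
  qed
  moreover have "optimal_compositions (3 * m + 2) \<noteq> {}" by (intro optimal_compositions_nonempty) simp
  ultimately obtain w where w: "w \<in> optimal_compositions (3 * m + 2)" "w \<in> ?R" by blast
  have "?R \<subseteq> optimal_compositions (3 * m + 2)"
  proof
    fix v assume "v \<in> ?R"
    then obtain i j where v: "v = replicate i 3 @ 2 # replicate j 3" "1 \<le> i" "1 \<le> j" "i + j = m" by blast
    have "word_kernel w 1 1 = 6 / 5 / 3 ^ m" using w(2) val by blast
    then show "v \<in> optimal_compositions (3 * m + 2)"
      using optimal_compositions_cong[OF w(1) word[OF v(4)]] val[OF v(2-4)] v(1) by simp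
  qed
  with * show ?thesis by blast
qed

section \<open>Cutting words\<close>

text \<open>Positions count from 1 as in \<open>peak_set\<close>, so the letter at position
  \<open>i\<close> is \<open>w ! (i - 1)\<close>. Lists are used because the pieces of a cut word
  have arbitrary letter sets.\<close>

definition word_peaks :: "nat list \<Rightarrow> nat set" where
  "word_peaks w = {i. 2 \<le> i \<and> i < length w \<and> w ! (i - 2) < w ! (i - 1) \<and> w ! i < w ! (i - 1)}"

definition peak_words :: "nat set \<Rightarrow> nat set \<Rightarrow> nat list set" where
  "peak_words A S = {w \<in> permutations_of_set A. word_peaks w = S}"

lemma finite_peak_words: "finite (peak_words A S)"
  by (simp add: peak_words_def)

lemma length_peak_words: "w \<in> peak_words A S \<Longrightarrow> length w = card A"
  by (auto simp: peak_words_def permutations_of_set_def distinct_card)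

lemma word_peaks_map:
  assumes "strict_mono_on A h" "set w \<subseteq> A"
  shows "word_peaks (map h w) = word_peaks w"
proof -
  have "h (w ! i) < h (w ! j) \<longleftrightarrow> w ! i < w ! j" if "i < length w" "j < length w" for i j
    using assms that by (intro strict_mono_on_less[OF assms(1)]) auto
  then show ?thesis by (auto simp: word_peaks_def)
qed

lemma card_peak_words_image:
  assumes "strict_mono_on A h"
  shows "card (peak_words (h ` A) S) = card (peak_words A S)"
proof -
  have inj: "inj_on h A" using assms by (rule strict_mono_on_imp_inj_on)
  have "word_peaks (map h w) = word_peaks w" if "w \<in> permutations_of_set A" for w
    using word_peaks_map[OF assms, of w] that by (simp add: permutations_of_set_def)
  then have "peak_words (h ` A) S = map h ` peak_words A S"
    unfolding peak_words_def permutations_of_set_image_inj[OF inj] by auto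
  moreover have "inj_on (map h) (peak_words A S)"
    by (rule inj_on_subset[OF inj_on_map_lists[OF inj]]) (auto simp: peak_words_def permutations_of_set_def lists_eq_set)
  ultimately show ?thesis by (simp add: card_image)
qed

lemma word_peaks_permutation:
  "word_peaks (map \<sigma> [1..<Suc n]) = peak_set n \<sigma>"
proof -
  have *: "map \<sigma> [1..<Suc n] ! (i - 1) = \<sigma> i" if "1 \<le> i" "i \<le> n" for i
    using that by (subst nth_map) (auto simp del: upt_Suc)
  have "map \<sigma> [1..<Suc n] ! (i - 2) = \<sigma> (i - 1) \<and> map \<sigma> [1..<Suc n] ! i = \<sigma> (i + 1)"
    if "2 \<le> i" "i < n" for i
    using *[of "i - 1"] *[of "i + 1"] that by (simp add: numeral_2_eq_2 del: upt_Suc)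
  then show ?thesis
    unfolding word_peaks_def peak_set_def using * by (auto simp del: upt_Suc)
qed

lemma card_peak_words_interval: "card (peak_words {1..n} S) = P_set S n"
proof -
  let ?w = "\<lambda>\<sigma>. map \<sigma> [1..<Suc n]"
  have "bij_betw ?w {\<sigma>. \<sigma> permutes {1..n} \<and> peak_set n \<sigma> = S} (peak_words {1..n} S)"
  proof (rule bij_betw_imageI)
    show "inj_on ?w {\<sigma>. \<sigma> permutes {1..n} \<and> peak_set n \<sigma> = S}"
    proof (rule inj_onI, rule ext)
      fix \<sigma> \<tau> i assume *: "\<sigma> \<in> {\<sigma>. \<sigma> permutes {1..n} \<and> peak_set n \<sigma> = S}"
        "\<tau> \<in> {\<sigma>. \<sigma> permutes {1..n} \<and> peak_set n \<sigma> = S}" "?w \<sigma> = ?w \<tau>"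
      show "\<sigma> i = \<tau> i"
      proof (cases "i \<in> {1..n}")
        case True
        with *(3) show ?thesis by (auto simp del: upt_Suc)
      next
        case False
        with * show ?thesis
          using permutes_not_in[of \<sigma> "{1..n}" i] permutes_not_in[of \<tau> "{1..n}" i] by simp
      qed
    qed
    show "?w ` {\<sigma>. \<sigma> permutes {1..n} \<and> peak_set n \<sigma> = S} = peak_words {1..n} S"
    proof (intro equalityI subsetI)
      fix w assume "w \<in> ?w ` {\<sigma>. \<sigma> permutes {1..n} \<and> peak_set n \<sigma> = S}"
      then obtain \<sigma> where \<sigma>: "w = ?w \<sigma>" "\<sigma> permutes {1..n}" "peak_set n \<sigma> = S" by auto
      have "set [1..<Suc n] = {1..n}" by auto
      then have "set w = {1..n}" "distinct w"
        unfolding \<sigma>(1) distinct_map set_map using permutes_image[OF \<sigma>(2)] permutes_inj_on[OF \<sigma>(2)]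
        by (simp_all del: upt_Suc)
      then show "w \<in> peak_words {1..n} S"
        using \<sigma> word_peaks_permutation by (simp add: peak_words_def permutations_of_set_def)
    next
      fix w assume "w \<in> peak_words {1..n} S"
      then have w: "set w = {1..n}" "distinct w" "word_peaks w = S" 
        by (auto simp: peak_words_def permutations_of_set_def)
      then have len: "length w = n" using distinct_card[of w] by simp
      define \<sigma> where "\<sigma> i = (if i \<in> {1..n} then w ! (i - 1) else i)" for i
      have eq: "?w \<sigma> = w" by (rule nth_equalityI) (auto simp: len \<sigma>_def simp del: upt_Suc)
      have "bij_betw \<sigma> {1..n} {1..n}"
      proof (rule bij_betw_imageI)
        show "inj_on \<sigma> {1..n}"
          using w(2) by (auto simp: inj_on_def \<sigma>_def nth_eq_iff_index_eq len)
        have "{1..n} = set [1..<Suc n]" by auto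
        then have "\<sigma> ` {1..n} = set (?w \<sigma>)" by (simp only: set_map)
        then show "\<sigma> ` {1..n} = {1..n}" unfolding eq w(1) .
      qed
      then have "\<sigma> permutes {1..n}"
        by (rule bij_imp_permutes) (simp add: \<sigma>_def del: atLeastAtMost_iff)
      moreover have "peak_set n \<sigma> = S" using word_peaks_permutation[of \<sigma> n] eq w by simp
      ultimately show "w \<in> ?w ` {\<sigma>. \<sigma> permutes {1..n} \<and> peak_set n \<sigma> = S}"
        using eq by force
    qed
  qed
  then show ?thesis unfolding P_set_def by (simp add: bij_betw_same_card)
qed

text \<open>Standardization: an order isomorphism from an initial segment onto \<open>A\<close>
  preserves every comparison, hence every peak.\<close>

lemma card_peak_words:
  assumes "finite A"
  shows "card (peak_words A S) = P_set S (card A)"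
proof -
  obtain h where h: "bij_betw h {..<card A} A" "strict_mono_on {..<card A} h"
    using ex_bij_betw_strict_mono_card[OF assms] by blast
  have "card (peak_words A S) = card (peak_words {..<card A} S)"
    using card_peak_words_image[OF h(2)] h(1) by (simp add: bij_betw_imp_surj_on)
  also have "\<dots> = card (peak_words (Suc ` {..<card A}) S)"
    by (rule card_peak_words_image[symmetric]) (simp add: strict_mono_on_def)
  also have "Suc ` {..<card A} = {1..card A}" by (simp add: image_Suc_lessThan)
  finally show ?thesis unfolding card_peak_words_interval .
qed

text \<open>Being a peak at \<open>i\<close> concerns the letters at \<open>i - 1\<close>,
  \<open>i\<close>, \<open>i + 1\<close>; these lie in one piece unless \<open>i\<close> is the last
  position of \<open>u\<close> or the first of \<open>v\<close>.\<close>

lemma word_peaks_append: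
  "word_peaks (u @ v) - {length u, Suc (length u)} = word_peaks u \<union> (+) (length u) ` word_peaks v"
  (is "?L = ?R")
proof -
  have nth: "(u @ v) ! (length u + j - k) = v ! (j - k)" if "k \<le> j" for j k
    using that by (metis Nat.add_diff_assoc nth_append_length_plus)
  show ?thesis
  proof (intro equalityI subsetI)
    fix i assume i: "i \<in> ?L"
    then have "i < length u \<or> length u + 2 \<le> i" by auto
    then show "i \<in> ?R"
    proof
      assume "i < length u"
      then have "i - 2 < length u" "i - 1 < length u" by auto
      with i \<open>i < length u\<close> have "i \<in> word_peaks u" by (simp add: word_peaks_def nth_append)
      then show ?thesis by simp
    next
      assume "length u + 2 \<le> i"
      define j where "j = i - length u"
      have j: "i = length u + j" "2 \<le> j" using \<open>length u + 2 \<le> i\<close> by (simp_all add: j_def)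
      then have "j \<in> word_peaks v"
        using i nth[of 2 j] nth[of 1 j] nth[of 0 j] by (simp add: word_peaks_def)
      with j show ?thesis by auto
    qed
  next
    fix i assume "i \<in> ?R"
    then show "i \<in> ?L"
    proof
      assume i: "i \<in> word_peaks u"
      then have "i < length u" "i - 2 < length u" "i - 1 < length u" by (auto simp: word_peaks_def)
      with i show ?thesis by (simp add: word_peaks_def nth_append)
    next
      assume "i \<in> (+) (length u) ` word_peaks v"
      then obtain j where j: "i = length u + j" "j \<in> word_peaks v" by auto
      then have "2 \<le> j" by (simp add: word_peaks_def)
      with j show ?thesis
        using nth[of 2 j] nth[of 1 j] nth[of 0 j] by (simp add: word_peaks_def)
    qed
  qed
qed

text \<open>Sort the words by the set \<open>B\<close> of their first \<open>m\<close> letters. The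
  binomial coefficient counts the choices of \<open>B\<close>, and by standardization the two pieces
  are counted by their lengths alone.\<close>

lemma P_set_cut_aux:
  assumes "m \<le> n" and S: "\<forall>i\<in>S. 2 \<le> i"
  shows "(n choose m) * P_set {} m * P_set S (n - m)
    = card {w \<in> permutations_of_set {1..n}. word_peaks w - {m, Suc m} = (+) m ` S}"
proof -
  let ?I = "{B. B \<subseteq> {1..n} \<and> card B = m}"
  let ?Q = "\<lambda>B. peak_words B {} \<times> peak_words ({1..n} - B) S"
  let ?W = "{w \<in> permutations_of_set {1..n}. word_peaks w - {m, Suc m} = (+) m ` S}"
  have fin: "finite B" if "B \<in> ?I" for B using that finite_subset[of B "{1..n}"] by auto
  have "bij_betw (\<lambda>w. (set (take m w), take m w, drop m w)) ?W (Sigma ?I ?Q)"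
  proof (rule bij_betw_byWitness[where f' = "\<lambda>(B, u, v). u @ v"])
    show "(\<lambda>w. (set (take m w), take m w, drop m w)) ` ?W \<subseteq> Sigma ?I ?Q"
    proof (rule image_subsetI)
      fix w assume "w \<in> ?W"
      then have w: "set w = {1..n}" "distinct w" "word_peaks w - {m, Suc m} = (+) m ` S"
        by (auto simp: permutations_of_set_def)
      then have len: "length w = n" using distinct_card[of w] by simp
      then have lenm: "length (take m w) = m" using assms by simp
      have peaks: "word_peaks (take m w) \<union> (+) m ` word_peaks (drop m w) = (+) m ` S"
        using word_peaks_append[of "take m w" "drop m w"] w(3) lenm by simp
      \<comment> \<open>Peaks of the first piece lie below \<open>m\<close>, all elements of the
        shifted \<open>S\<close> do not.\<close>
      have "word_peaks (take m w) = {}"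
      proof -
        have "i < m" if "i \<in> word_peaks (take m w)" for i using that lenm by (simp add: word_peaks_def)
        moreover have "m \<le> i" if "i \<in> (+) m ` S" for i using that by auto
        ultimately show ?thesis using peaks by fastforce
      qed
      moreover from this have "word_peaks (drop m w) = S" using peaks by (simp add: inj_image_eq_iff)
      moreover have "set (drop m w) = {1..n} - set (take m w)"
      proof -
        have "set (take m w) \<union> set (drop m w) = {1..n}" using w(1)
          by (metis append_take_drop_id set_append)
        moreover have "set (take m w) \<inter> set (drop m w) = {}"
          using w(2) by (metis append_take_drop_id distinct_append)
        ultimately show ?thesis by auto
      qed
      moreover have "set (take m w) \<subseteq> {1..n}" using w(1) set_take_subset[of m w] by simp
      moreover have "card (set (take m w)) = m" using w(2) lenm by (simp add: distinct_card)
      ultimately show "(set (take m w), take m w, drop m w) \<in> Sigma ?I ?Q"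
        using w(2) by (simp add: peak_words_def permutations_of_set_def)
    qed
    show "(\<lambda>(B, u, v). u @ v) ` Sigma ?I ?Q \<subseteq> ?W"
    proof (rule image_subsetI, clarify)
      fix B u v assume B: "B \<subseteq> {1..n}" "m = card B" and u: "u \<in> peak_words B {}"
        and v: "v \<in> peak_words ({1..n} - B) S"
      have "length u = m" using length_peak_words[OF u] B by simp
      then show "u @ v \<in> permutations_of_set {1..n}
        \<and> word_peaks (u @ v) - {card B, Suc (card B)} = (+) (card B) ` S"
        using B u v word_peaks_append[of u v] by (auto simp: peak_words_def permutations_of_set_def)
    qed
    show "\<forall>t\<in>Sigma ?I ?Q. (\<lambda>w. (set (take m w), take m w, drop m w)) ((\<lambda>(B, u, v). u @ v) t) = t"
    proof
      fix t assume "t \<in> Sigma ?I ?Q"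
      then obtain B u v where t: "t = (B, u, v)" "u \<in> peak_words B {}" "card B = m" by auto
      then have "length u = m" "set u = B"
        using length_peak_words[of u B "{}"] by (simp_all add: peak_words_def permutations_of_set_def)
      with t show "(\<lambda>w. (set (take m w), take m w, drop m w)) ((\<lambda>(B, u, v). u @ v) t) = t" by simp
    qed
  qed simp
  then have "card ?W = card (Sigma ?I ?Q)" by (rule bij_betw_same_card)
  also have "\<dots> = (\<Sum>B\<in>?I. card (?Q B))"
    by (rule card_SigmaI) (auto simp: finite_peak_words)
  also have "\<dots> = (\<Sum>B\<in>?I. P_set {} m * P_set S (n - m))"
  proof (rule sum.cong)
    fix B assume B: "B \<in> ?I"
    then have "card ({1..n} - B) = n - m" using fin[OF B] by (simp add: card_Diff_subset)
    with B show "card (?Q B) = P_set {} m * P_set S (n - m)"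
      using fin[OF B] by (simp add: card_cartesian_product card_peak_words)
  qed simp
  also have "\<dots> = (n choose m) * P_set {} m * P_set S (n - m)"
    by (simp add: n_subsets)
  finally show ?thesis by simp
qed

text \<open>Cut the word of a permutation after its \<open>m\<close>-th letter: only \<open>m\<close> and \<open>m + 1\<close> can cease to be
  peaks, and at most one of them is a peak.\<close>

lemma P_set_cut:
  assumes "m \<le> n" and S: "\<forall>i\<in>S. 2 \<le> i"
  shows "(n choose m) * P_set {} m * P_set S (n - m)
    = P_set ((+) m ` S) n + P_set (insert m ((+) m ` S)) n + P_set (insert (Suc m) ((+) m ` S)) n"
proof -
  let ?T = "(+) m ` S"
  have T: "m \<notin> ?T" "Suc m \<notin> ?T" using S by auto
  have "{w \<in> permutations_of_set {1..n}. word_peaks w - {m, Suc m} = ?T}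
      = peak_words {1..n} ?T \<union> (peak_words {1..n} (insert m ?T) \<union> peak_words {1..n} (insert (Suc m) ?T))"
  proof -
    have "word_peaks w - {m, Suc m} = ?T \<longleftrightarrow>
        word_peaks w = ?T \<or> word_peaks w = insert m ?T \<or> word_peaks w = insert (Suc m) ?T" for w
    proof -
      have "\<not> (m \<in> word_peaks w \<and> Suc m \<in> word_peaks w)"
        by (auto simp: word_peaks_def)
      then show ?thesis using T by auto
    qed
    then show ?thesis by (auto simp: peak_words_def)
  qed
  moreover have "card \<dots> = card (peak_words {1..n} ?T)
      + (card (peak_words {1..n} (insert m ?T)) + card (peak_words {1..n} (insert (Suc m) ?T)))"
  proof -
    have "?T \<noteq> insert m ?T" "?T \<noteq> insert (Suc m) ?T" "insert m ?T \<noteq> insert (Suc m) ?T"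
      using T by (metis insertCI, metis insertCI, metis insertCI insertE n_not_Suc_n)
    moreover have "peak_words A S \<inter> peak_words A S' = {}" if "S \<noteq> S'" for A S S'
      using that by (auto simp: peak_words_def)
    ultimately show ?thesis
      by (simp add: card_Un_disjoint finite_peak_words Int_Un_distrib)
  qed
  ultimately show ?thesis
    using P_set_cut_aux[OF assms] by (simp add: card_peak_words)
qed

section \<open>Words without peaks\<close>

lemma word_peaks_Cons: "\<forall>x\<in>set w. x < M \<Longrightarrow> word_peaks w = {} \<Longrightarrow> word_peaks (M # w) = {}"
proof (rule ccontr)
  assume *: "\<forall>x\<in>set w. x < M" "word_peaks w = {}" "word_peaks (M # w) \<noteq> {}"
  then obtain i where i: "i \<in> word_peaks (M # w)" by auto
  have "i \<noteq> 2"
  proof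
    assume "i = 2"
    with i have "M < w ! 0" "w ! 0 \<in> set w" by (auto simp: word_peaks_def numeral_2_eq_2 intro: nth_mem)
    with *(1) show False by force
  qed
  with i have "3 \<le> i" by (simp add: word_peaks_def)
  then obtain j where "i = 3 + j" using le_Suc_ex by blast
  then have "i = Suc (Suc (Suc j))" by simp
  with i have "Suc (Suc j) \<in> word_peaks w" by (simp add: word_peaks_def)
  with *(2) show False by simp
qed

lemma word_peaks_snoc: "\<forall>x\<in>set w. x < M \<Longrightarrow> word_peaks w = {} \<Longrightarrow> word_peaks (w @ [M]) = {}"
proof (rule ccontr)
  assume *: "\<forall>x\<in>set w. x < M" "word_peaks w = {}" "word_peaks (w @ [M]) \<noteq> {}"
  then obtain i where i: "i \<in> word_peaks (w @ [M])" by auto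
  have "i \<noteq> length w"
  proof
    assume il: "i = length w"
    with i have "length w - 1 < length w" by (auto simp: word_peaks_def)
    with il i have "M < w ! (length w - 1)" "w ! (length w - 1) \<in> set w"
      by (simp_all add: word_peaks_def nth_append)
    with *(1) show False by force
  qed
  with i have "i < length w" "i - 2 < length w" "i - 1 < length w" by (auto simp: word_peaks_def)
  with i have "i \<in> word_peaks w" by (simp add: word_peaks_def nth_append)
  with *(2) show False by simp
qed

lemma word_peaks_maximum:
  assumes "w = u @ M # v" "word_peaks w = {}" "distinct w" "\<forall>x\<in>set w. x \<le> M"
  shows "u = [] \<or> v = []"
proof (rule ccontr)
  assume "\<not> (u = [] \<or> v = [])"
  then obtain u' a b v' where uv: "u = u' @ [a]" "v = b # v'" by (metis list.exhaust rev_exhaust)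
  with assms have "a < M" "b < M" by (auto simp: le_neq_implies_less)
  then have "length u' + 2 \<in> word_peaks w"
    unfolding assms(1) uv by (auto simp: word_peaks_def nth_append)
  with assms(2) show False by simp
qed

lemma word_peaks_tl: "word_peaks (M # w) = {} \<Longrightarrow> word_peaks w = {}"
  using word_peaks_append[of "[M]" w] by auto

lemma word_peaks_butlast: "word_peaks (w @ [M]) = {} \<Longrightarrow> word_peaks w = {}"
  using word_peaks_append[of w "[M]"] by auto

text \<open>In a word without peaks the largest letter stands at one of the two ends, and removing
  it or putting it back creates no peak; each new letter doubles the count.\<close>

lemma P_set_empty: "P_set {} (Suc n) = 2 ^ n"
proof (induction n)
  case 0
  have "peak_words {0} {} = {[0]}" by (auto simp: peak_words_def word_peaks_def)
  then show ?case using card_peak_words[of "{0}" "{}"] by simp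
next
  case (Suc n)
  let ?A = "{..Suc n}" and ?M = "Suc n"
  let ?B = "{..n}"
  have A: "?A = insert ?M ?B" by auto
  have "peak_words ?A {} = (#) ?M ` peak_words ?B {}
    \<union> (\<lambda>w. w @ [?M]) ` peak_words ?B {}" (is "?L = ?R1 \<union> ?R2")
  proof (intro equalityI subsetI)
    fix w assume "w \<in> ?L"
    then have w: "set w = ?A" "distinct w" "word_peaks w = {}"
      by (auto simp: peak_words_def permutations_of_set_def)
    then have "?M \<in> set w" by simp
    then obtain u v where uv: "w = u @ ?M # v" by (auto simp: in_set_conv_decomp)
    then consider "u = []" | "v = []" using word_peaks_maximum[OF uv w(3,2)] w(1) by auto
    then show "w \<in> ?R1 \<union> ?R2"
    proof cases
      case 1
      then have "set v = ?B" using uv w(1,2) by (simp add: A insert_ident)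
      with 1 uv w have "v \<in> peak_words ?B {}"
        by (auto simp: peak_words_def permutations_of_set_def dest: word_peaks_tl)
      with 1 uv show ?thesis by simp
    next
      case 2
      then have "set u = ?B" using uv w(1,2) by (simp add: A insert_ident)
      with 2 uv w have "u \<in> peak_words ?B {}"
        by (auto simp: peak_words_def permutations_of_set_def dest: word_peaks_butlast)
      with 2 uv show ?thesis by simp
    qed
  next
    fix w assume "w \<in> ?R1 \<union> ?R2"
    then obtain v where v: "v \<in> peak_words ?B {}" "w = ?M # v \<or> w = v @ [?M]" by auto
    then have v': "set v = ?B" "distinct v" "word_peaks v = {}" 
      by (auto simp: peak_words_def permutations_of_set_def)
    then have "\<forall>x\<in>set v. x < ?M" by auto
    with v' v(2) show "w \<in> ?L"
      by (auto simp: peak_words_def permutations_of_set_def A word_peaks_Cons word_peaks_snoc)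
  qed
  moreover have "?R1 \<inter> ?R2 = {}"
  proof -
    have False if v: "v \<in> peak_words ?B {}" and u: "u \<in> peak_words ?B {}" and eq: "?M # v
      = u @ [?M]" for u v
    proof (cases u)
      case Nil
      with length_peak_words[OF u] show False by simp
    next
      case (Cons a u')
      with eq have "?M \<in> set u" by simp
      with u show False by (auto simp: peak_words_def permutations_of_set_def)
    qed
    then show ?thesis by auto
  qed
  ultimately have "card (peak_words ?A {}) = card ?R1 + card ?R2"
    by (simp add: card_Un_disjoint finite_peak_words)
  also have "card ?R1 = card (peak_words ?B {})" by (intro card_image inj_onI) simp
  also have "card ?R2 = card (peak_words ?B {})" by (intro card_image inj_onI) simp
  finally show ?case using Suc card_peak_words[of ?A "{}"] card_peak_words[of ?B "{}"] by simp
qed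

section \<open>Peak sets and compositions\<close>

text \<open>The full sum is left out, so the last part does not matter: a composition of
  \<open>n\<close> and the extended one of \<open>n + 1\<close> yield the same peak set.\<close>

fun partial_sums :: "nat list \<Rightarrow> nat set" where
  "partial_sums [] = {}"
| "partial_sums [c] = {}"
| "partial_sums (c # d # cs) = insert c ((+) c ` partial_sums (d # cs))"

lemma partial_sums_Cons: "cs \<noteq> [] \<Longrightarrow> partial_sums (c # cs) = insert c ((+) c ` partial_sums cs)"
  by (cases cs) auto

lemma partial_sums_add: "(+) p ` partial_sums (c # cs) = partial_sums ((p + c) # cs)"
  by (cases cs) (auto simp: image_image add.assoc)

lemma partial_sums_bounds:
  assumes "\<forall>c\<in>set w. 1 \<le> c" "i \<in> partial_sums w"
  shows "1 \<le> i \<and> i < sum_list w"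
  using assms
proof (induction w arbitrary: i rule: partial_sums.induct)
  case (3 c d cs)
  from 3(3) consider "i = c" | j where "i = c + j" "j \<in> partial_sums (d # cs)" by auto
  then show ?case
  proof cases
    case 1
    then show ?thesis using 3(2) by auto
  next
    case 2
    with 3(1)[of j] 3(2) show ?thesis by auto
  qed
qed auto

section \<open>Peak probabilities\<close>

lemma P_set_eq_0:
  assumes "i \<in> S" "\<not> (2 \<le> i \<and> i < n) \<or> Suc i \<in> S"
  shows "P_set S n = 0"
proof -
  have "False" if "peak_set n \<sigma> = S" for \<sigma>
    using assms that by (auto simp: peak_set_def)
  then have "{\<sigma>. \<sigma> permutes {1..n} \<and> peak_set n \<sigma> = S} = {}" by blast
  then show ?thesis unfolding P_set_def by (simp only: card.empty)
qed

text \<open>The parts sum to the number of letters plus one, hence the subtraction. Division by the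
  factorial absorbs the binomial coefficient of the cut.\<close>

definition peak_prob :: "nat list \<Rightarrow> real" where
  "peak_prob w = P_set (partial_sums w) (sum_list w - 1) / fact (sum_list w - 1)"

lemma P_set_no_peaks: "P_set {} p / fact p = K (Suc p) 1 1" if "1 \<le> p"
proof -
  from that obtain k where "p = Suc k" by (metis Suc_le_D One_nat_def)
  then show ?thesis by (simp add: P_set_empty K_def del: fact_Suc)
qed

lemma peak_prob_rule:
  assumes "1 \<le> p" "1 \<le> q" "\<forall>c\<in>set cs. 1 \<le> c"
  shows "K (Suc p) 1 1 * peak_prob (Suc q # cs)
    = peak_prob (Suc (p + q) # cs) + peak_prob (p # Suc q # cs) + peak_prob (Suc p # q # cs)"
proof (cases "\<forall>i\<in>partial_sums (Suc q # cs). 2 \<le> i")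
  case True
  define n where "n = p + q + sum_list cs"
  let ?S = "partial_sums (Suc q # cs)"
  have S: "partial_sums (Suc p # q # cs) = insert (Suc p) (partial_sums (Suc (p + q) # cs))"
    using partial_sums_add[of "Suc p" q cs] by (simp only: partial_sums.simps(3) add_Suc)
  have sum: "sum_list (Suc (p + q) # cs) - 1 = n" "sum_list (p # Suc q # cs) - 1 = n"
    "sum_list (Suc p # q # cs) - 1 = n" "sum_list (Suc q # cs) - 1 = n - p"
    by (simp_all add: n_def)
  have "K (Suc p) 1 1 * peak_prob (Suc q # cs) = (P_set {} p / fact p) * (P_set ?S (n - p) / fact (n
    - p))"
    by (simp only: P_set_no_peaks[OF assms(1)] peak_prob_def sum)
  also have "\<dots> = real ((n choose p) * P_set {} p * P_set ?S (n - p)) / fact n"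
    by (simp add: binomial_fact n_def)
  also have "(n choose p) * P_set {} p * P_set ?S (n - p)
      = P_set (partial_sums (Suc (p + q) # cs)) n + P_set (partial_sums (p # Suc q # cs)) n
        + P_set (partial_sums (Suc p # q # cs)) n"
    using P_set_cut[of p n ?S] True unfolding S by (simp add: n_def partial_sums_add)
  finally show ?thesis by (simp only: peak_prob_def sum of_nat_add add_divide_distrib)
next
  case False
  have "2 \<le> i" if "i \<in> partial_sums (Suc q # cs)" for i
    using that assms by (cases cs) auto
  with False show ?thesis by blast
qed

text \<open>The product rule determines both sides from compositions with a single part, by induction on the
  number of parts and then on the first part.\<close>

lemma peak_prob_eq_word_kernel:
  assumes "w \<noteq> []" "w \<noteq> [1]" "\<forall>c\<in>set w. 1 \<le> c"
  shows "peak_prob w = word_kernel w 1 1"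
proof -
  have "\<forall>w. length w = Suc n \<longrightarrow> w \<noteq> [1] \<longrightarrow> (\<forall>c\<in>set w. 1 \<le> c) \<longrightarrow> peak_prob w = word_kernel w 1 1" for n
  proof (induction n)
    case 0
    show ?case
    proof (intro allI impI)
      fix w :: "nat list" assume w: "length w = Suc 0" "w \<noteq> [1]" "\<forall>c\<in>set w. 1 \<le> c"
      then obtain c where c: "w = [c]" by (auto simp: length_Suc_conv)
      with w have "2 \<le> c" by auto
      then have "K c 1 1 = P_set {} (c - 1) / fact (c - 1)" 
        using P_set_no_peaks[of "c - 1"] by simp
      then show "peak_prob w = word_kernel w 1 1" by (simp add: c peak_prob_def)
    qed
  next
    case (Suc n)
    have "\<forall>d cs. length cs = n \<longrightarrow> 1 \<le> c \<longrightarrow> 1 \<le> d \<longrightarrow> (\<forall>c\<in>set cs. 1 \<le> c)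
      \<longrightarrow> peak_prob (c # d # cs) = word_kernel (c # d # cs) 1 1" for c
    proof (induction c)
      case (Suc p)
      show ?case
      proof (intro allI impI)
        fix d :: nat and cs :: "nat list" assume *: "length cs = n" "1 \<le> d" "\<forall>c\<in>set cs. 1 \<le> c"
        show "peak_prob (Suc p # d # cs) = word_kernel (Suc p # d # cs) 1 1"
        proof (cases "p = 0")
          case True
          have "P_set (partial_sums (1 # d # cs)) n = 0" for n
            by (rule P_set_eq_0[of 1]) auto
          then show ?thesis using True word_kernel_part_1[of "1 # d # cs"] by (simp add: peak_prob_def)
        next
          case False
          then have p: "1 \<le> p" by simp
          have "peak_prob (Suc d # cs) = word_kernel (Suc d # cs) 1 1"
            "peak_prob (Suc (p + d) # cs) = word_kernel (Suc (p + d) # cs) 1 1"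
            using \<open>\<forall>w. length w = Suc n \<longrightarrow> _\<close> * p by auto
          moreover have "peak_prob (p # Suc d # cs) = word_kernel (p # Suc d # cs) 1 1"
            using Suc * p by auto
          ultimately show ?thesis
            using peak_prob_rule[of p d cs] word_kernel_rule[of p d 1 1 cs] p * by simp
        qed
      qed
    qed simp
    then show ?case by (auto simp: length_Suc_conv)
  qed
  moreover obtain n where "length w = Suc n" using assms(1) by (cases w) auto
  ultimately show ?thesis using assms by blast
qed

lemma P_set_eq_word_kernel:
  assumes "w \<in> extended_compositions (Suc n)"
  shows "real (P_set (partial_sums w) n) = word_kernel w 1 1 * fact n"
proof -
  have "peak_prob w = word_kernel w 1 1"
    using assms by (intro peak_prob_eq_word_kernel) (auto simp: extended_compositions_def)
  moreover have "sum_list w = Suc n" using assms by (simp add: extended_compositions_def)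
  ultimately show ?thesis by (simp add: peak_prob_def field_simps)
qed

section \<open>From peak sets to extended compositions\<close>

lemma partial_sums_surj:
  assumes "0 < N" "S \<subseteq> {1..<N}"
  shows "\<exists>w. w \<noteq> [] \<and> (\<forall>c\<in>set w. 1 \<le> c) \<and> sum_list w = N \<and> partial_sums w = S"
  using assms
proof (induction N arbitrary: S rule: less_induct)
  case (less N)
  have fin: "finite S" using less.prems(2) finite_subset by blast
  show ?case
  proof (cases "S = {}")
    case True
    then show ?thesis using less.prems by (intro exI[of _ "[N]"]) simp
  next
    case False
    \<comment> \<open>The least element becomes the first part; the remaining elements, shifted down
      by it, form a smaller instance.\<close>
    define c where "c = Min S"
    have c: "c \<in> S" "\<And>i. i \<in> S \<Longrightarrow> c \<le> i" using False fin by (auto simp: c_def)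
    then have cN: "1 \<le> c" "c < N" using less.prems(2) by auto
    define S' where "S' = {i - c | i. i \<in> S \<and> c < i}"
    have "S' \<subseteq> {1..<N - c}"
    proof
      fix j assume "j \<in> S'"
      then obtain i where i: "j = i - c" "i \<in> S" "c < i" by (auto simp: S'_def)
      with less.prems(2) have "i < N" by auto
      with i show "j \<in> {1..<N - c}" by (auto simp: diff_less_mono)
    qed
    with less.IH[of "N - c" S'] cN obtain w where w: "w \<noteq> []" "\<forall>c\<in>set w. 1 \<le> c"
      "sum_list w = N - c" "partial_sums w = S'" by auto
    have "insert c ((+) c ` S') = S"
    proof (intro equalityI subsetI)
      fix i assume i: "i \<in> S"
      show "i \<in> insert c ((+) c ` S')"
      proof (cases "i = c")
        case False
        with i c(2)[of i] have "i - c \<in> S'" "i = c + (i - c)" by (auto simp: S'_def)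
        then show ?thesis by blast
      qed simp
    qed (auto simp: S'_def c)
    with w cN show ?thesis by (intro exI[of _ "c # w"]) (auto simp: partial_sums_Cons)
  qed
qed

text \<open>The lower bound on the sums handles the first part, the absence of consecutive sums the
  inner ones, and the distance of at least 2 from the total the last one.\<close>

lemma partial_sums_parts_ge_2:
  assumes "\<forall>c\<in>set w. 1 \<le> c" "2 \<le> length w"
    and "\<forall>i\<in>partial_sums w. 2 \<le> i \<and> i < sum_list w - 1 \<and> Suc i \<notin> partial_sums w"
  shows "\<forall>c\<in>set w. 2 \<le> c"
  using assms
proof (induction w rule: partial_sums.induct)
  case (3 c d cs)
  let ?T = "partial_sums (d # cs)"
  have c: "2 \<le> c" "c < sum_list (c # d # cs) - 1" "Suc c \<notin> partial_sums (c # d # cs)" using 3(4) by auto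
  have shift: "2 \<le> i \<and> i < sum_list (d # cs) - 1 \<and> Suc i \<notin> ?T" if i: "i \<in> ?T" for i
  proof -
    have ci: "c + i \<in> partial_sums (c # d # cs)" using i by simp
    then have "c + i < sum_list (c # d # cs) - 1" "Suc (c + i) \<notin> partial_sums (c # d # cs)" using 3(4)
      by blast+
    then have "i < sum_list (d # cs) - 1" "Suc i \<notin> ?T" by auto
    moreover have "1 \<le> i" using partial_sums_bounds[of "d # cs" i] 3(2) i by auto
    moreover have "i \<noteq> 1" using c(3) i by (auto simp: image_iff)
    ultimately show ?thesis by auto
  qed
  have "\<forall>c\<in>set (d # cs). 2 \<le> c"
  proof (cases "cs = []")
    case True
    then show ?thesis using c(2) by auto
  next
    case False
    then have "2 \<le> length (d # cs)" by (cases cs) auto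
    then show ?thesis using 3(1) 3(2) shift by auto
  qed
  with c show ?case by auto
qed auto

lemma extended_compositions_of_pos:
  assumes "\<forall>c\<in>set w. 1 \<le> c" "w \<noteq> []" "sum_list w = Suc n" "1 \<le> n" "0 < P_set (partial_sums w) n"
  shows "w \<in> extended_compositions (Suc n)"
proof (cases "2 \<le> length w")
  case True
  have "\<forall>i\<in>partial_sums w. 2 \<le> i \<and> i < sum_list w - 1 \<and> Suc i \<notin> partial_sums w"
    using P_set_eq_0[of _ "partial_sums w" n] assms(3,5) by fastforce
  from partial_sums_parts_ge_2[OF assms(1) True this] show ?thesis
    using assms by (simp add: extended_compositions_def)
next
  case False
  with assms(2) obtain c where "w = [c]" by (cases w; cases "tl w") auto
  with assms show ?thesis by (simp add: extended_compositions_def)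
qed

lemma P_set_pos_cases:
  assumes "1 \<le> n" "0 < P_set S n"
  obtains w where "w \<in> extended_compositions (Suc n)" "S = partial_sums w"
proof -
  have "S \<subseteq> {1..<Suc n}" using P_set_eq_0[of _ S n] assms by fastforce
  then obtain w where w: "w \<noteq> []" "\<forall>c\<in>set w. 1 \<le> c" "sum_list w = Suc n" "partial_sums w = S"
    using partial_sums_surj[of "Suc n" S] by auto
  with extended_compositions_of_pos[OF w(2,1,3) assms(1)] assms(2) that[of w] show ?thesis by simp
qed

lemma partial_sums_extended_compositions: "w \<in> extended_compositions (Suc n) \<Longrightarrow> partial_sums w \<subseteq> {1..n}"
  using partial_sums_bounds[of w] by (fastforce simp: extended_compositions_def)

lemma maximal_peak_sets_eq:
  assumes "1 \<le> n"
  shows "maximal_peak_sets n = partial_sums ` optimal_compositions (Suc n)"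
proof (intro equalityI subsetI)
  fix S assume S: "S \<in> maximal_peak_sets n"
  have "[Suc n] \<in> extended_compositions (Suc n)" using assms by (simp add: extended_compositions_def)
  \<comment> \<open>Comparison with the empty set shows that a maximal \<open>S\<close> is attained
    by some permutation, hence comes from an extended composition.\<close>
  have "0 < P_set {} n" using assms P_set_empty[of "n - 1"] by simp
  also have "\<dots> \<le> P_set S n" using S by (simp add: maximal_peak_sets_def)
  finally obtain w where w: "w \<in> extended_compositions (Suc n)" "S
    = partial_sums w" using P_set_pos_cases[OF assms] by blast
  have "word_kernel v 1 1 \<le> word_kernel w 1 1" if v: "v \<in> extended_compositions (Suc n)" for v
  proof -
    have "P_set (partial_sums v) n \<le> P_set (partial_sums w) n"
      using S w partial_sums_extended_compositions[OF v] by (simp add: maximal_peak_sets_def)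
    then have "word_kernel v 1 1 * fact n \<le> word_kernel w 1 1 * fact n"
      by (simp only: flip: P_set_eq_word_kernel[OF v] P_set_eq_word_kernel[OF w(1)])
    then show ?thesis by simp
  qed
  with w show "S \<in> partial_sums ` optimal_compositions (Suc n)" by (auto simp: optimal_compositions_def)
next
  fix S assume "S \<in> partial_sums ` optimal_compositions (Suc n)"
  then obtain w where w: "S = partial_sums w" "w \<in> optimal_compositions (Suc n)"
    "w \<in> extended_compositions (Suc n)"
    by (auto simp: optimal_compositions_def)
  have "P_set T n \<le> P_set S n" for T
  proof (cases "P_set T n = 0")
    case False
    then obtain v where v: "v \<in> extended_compositions (Suc n)" "T
      = partial_sums v" using P_set_pos_cases[OF assms] by blast
    with w have "word_kernel v 1 1 * fact n \<le> word_kernel w 1 1 * fact n"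
      by (simp add: optimal_compositions_def)
    then have "real (P_set T n) \<le> real (P_set S n)"
      by (simp only: v(2) w(1) P_set_eq_word_kernel[OF v(1)] P_set_eq_word_kernel[OF w(3)])
    then show ?thesis by simp
  qed simp
  then show "S \<in> maximal_peak_sets n"
    using w partial_sums_extended_compositions[of w n] by (simp add: maximal_peak_sets_def)
qed

section \<open>Peak compositions\<close>

fun prefix_sums :: "nat \<Rightarrow> nat list \<Rightarrow> nat list" where
  "prefix_sums a [] = []"
| "prefix_sums a [c] = []"
| "prefix_sums a (c # d # cs) = (a + c) # prefix_sums (a + c) (d # cs)"

lemma set_prefix_sums: "set (prefix_sums a c) = (+) a ` partial_sums c"
  by (induction a c rule: prefix_sums.induct) (auto simp: image_image add.assoc)

lemma sorted_prefix_sums: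
  "\<forall>x\<in>set c. 1 \<le> x \<Longrightarrow> sorted_wrt (<) (prefix_sums a c)"
proof (induction a c rule: prefix_sums.induct)
  case (3 a c d cs)
  then have "0 < i" if "i \<in> partial_sums (d # cs)" for i
    using partial_sums_bounds[of "d # cs" i] that by auto
  then show ?case using 3 by (auto simp: set_prefix_sums)
qed auto

lemma sorted_list_of_partial_sums:
  assumes "\<forall>x\<in>set c. 1 \<le> x"
  shows "sorted_list_of_set (partial_sums c) = prefix_sums 0 c"
proof -
  have "partial_sums c = set (prefix_sums 0 c)" by (simp add: set_prefix_sums)
  then show ?thesis
    using sorted_prefix_sums[OF assms, of 0]
    by (simp add: sorted_list_of_set.idem_if_sorted_distinct strict_sorted_iff)
qed

lemma differences_prefix_sums:
  "c \<noteq> [] \<Longrightarrow> map2 (-) (prefix_sums a c @ [a + sum_list c]) (a # prefix_sums a c) = c"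
proof (induction a c rule: prefix_sums.induct)
  case (3 a c d cs)
  then show ?case by (simp add: add.assoc)
qed auto

text \<open>Every peak set is the set of partial sums of some composition \<open>w\<close> of
  \<open>n\<close>, and taking differences of the sorted sums gives \<open>w\<close> back.\<close>

lemma peak_composition_iff:
  assumes "composition n c" "1 \<le> n"
  shows "peak_composition n \<sigma> = c \<longleftrightarrow> peak_set n \<sigma> = partial_sums c"
proof -
  have *: "peak_composition n \<sigma> = w"
    if "peak_set n \<sigma> = partial_sums w" "\<forall>x\<in>set w. 1 \<le> x" "sum_list w = n" "w \<noteq> []" for w
    using differences_prefix_sums[of w 0] that
    by (simp add: peak_composition_def sorted_list_of_partial_sums)
  have c: "\<forall>x\<in>set c. 1 \<le> x" "sum_list c = n" "c \<noteq> []"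
    using assms by (auto simp: composition_def)
  show ?thesis
  proof
    assume pc: "peak_composition n \<sigma> = c"
    have "peak_set n \<sigma> \<subseteq> {1..<n}" by (auto simp: peak_set_def)
    then obtain w where w: "w \<noteq> []" "\<forall>x\<in>set w. 1 \<le> x" "sum_list w = n" "partial_sums w = peak_set n \<sigma>"
      using partial_sums_surj[of n "peak_set n \<sigma>"] assms by auto
    with * have "peak_composition n \<sigma> = w" by blast
    with pc w show "peak_set n \<sigma> = partial_sums c" by simp
  qed (use * c in blast)
qed

lemma P_comp_eq:
  assumes "composition n c" "1 \<le> n"
  shows "P_comp c = P_set (partial_sums c) n"
proof -
  have "sum_list c = n" using assms by (simp add: composition_def)
  then show ?thesis by (simp add: P_comp_def P_set_def peak_composition_iff[OF assms])
qed

fun extend :: "nat list \<Rightarrow> nat list" where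
  "extend [] = []"
| "extend [c] = [Suc c]"
| "extend (c # d # cs) = c # extend (d # cs)"

lemma extend_snoc: "extend (c @ [x]) = c @ [Suc x]"
  by (induction c rule: extend.induct) auto

lemma partial_sums_snoc: "partial_sums (c @ [x]) = partial_sums (c @ [y])"
  by (induction c) (simp_all add: partial_sums_Cons)

text \<open>Compositions whose extension has a part 1 count no permutations and cannot compete with
  \<open>[n]\<close>, which has a positive count; for the others \<open>extend\<close> is a
  bijection onto the extended compositions.\<close>

lemma maximal_compositions_eq:
  assumes "1 \<le> n"
  shows "c \<in> maximal_compositions n \<longleftrightarrow> composition n c \<and> extend c \<in> optimal_compositions (Suc n)"
proof -
  have P: "P_comp c = P_set (partial_sums (extend c)) n"
    "sum_list (extend c) = Suc n" "\<forall>x\<in>set (extend c). 1 \<le> x" "extend c \<noteq> []"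
    if c: "composition n c" for c
  proof -
    have "c \<noteq> []" using c assms by (auto simp: composition_def)
    then obtain d x where "c = d @ [x]" by (metis rev_exhaust)
    then show "P_comp c = P_set (partial_sums (extend c)) n"
    "sum_list (extend c) = Suc n" "\<forall>x\<in>set (extend c). 1 \<le> x" "extend c \<noteq> []"
      using c P_comp_eq[OF c assms] partial_sums_snoc[of d x "Suc x"]
      by (auto simp: composition_def extend_snoc)
  qed
  have extended_compositions: "extend c \<in> extended_compositions (Suc n)"
    if "composition n c" "0 < P_comp c" for c
    using extended_compositions_of_pos[of "extend c" n] P[OF that(1)] that assms by simp
  have unextend: "\<exists>c. composition n c \<and> extend c = w" if w: "w \<in> extended_compositions (Suc n)" for w
  proof -
    have "w \<noteq> []" using w by (simp add: extended_compositions_def)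
    then obtain d x where d: "w = d @ [x]" by (metis rev_exhaust)
    with w have "composition n (d @ [x - 1])" "extend (d @ [x - 1]) = w"
      by (auto simp: composition_def extended_compositions_def extend_snoc)
    then show ?thesis by blast
  qed
  show ?thesis
  proof
    assume "c \<in> maximal_compositions n"
    then have c: "composition n c" "\<And>b. composition n b \<Longrightarrow> P_comp b \<le> P_comp c"
      by (auto simp: maximal_compositions_def maximal_composition_def composition_def)
    have n: "composition n [n]" using assms by (simp add: composition_def)
    have "0 < P_set {} n" using assms P_set_empty[of "n - 1"] by simp
    then have "0 < P_comp [n]" using P_comp_eq[OF n assms] by simp
    then have "0 < P_comp c" using c(2)[OF n] by simp
    with c(1) have w: "extend c \<in> extended_compositions (Suc n)" by (rule extended_compositions)
    have "word_kernel v 1 1 \<le> word_kernel (extend c) 1 1" if v: "v \<in> extended_compositions (Suc n)" for v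
    proof -
      from unextend[OF v] obtain b where b: "composition n b" "extend b = v" by blast
      have "real (P_comp b) \<le> real (P_comp c)" using c(2)[OF b(1)] by simp
      then have "word_kernel v 1 1 * fact n \<le> word_kernel (extend c) 1 1 * fact n"
        by (simp only: P(1)[OF b(1)] P(1)[OF c(1)] b(2) P_set_eq_word_kernel[OF v] P_set_eq_word_kernel[OF w])
      then show ?thesis by simp
    qed
    with c(1) w show "composition n c \<and> extend c \<in> optimal_compositions (Suc n)"
      by (simp add: optimal_compositions_def)
  next
    assume c: "composition n c \<and> extend c \<in> optimal_compositions (Suc n)"
    then have w: "extend c \<in> extended_compositions (Suc n)" by (simp add: optimal_compositions_def)
    have "P_comp b \<le> P_comp c" if b: "composition n b" for b
    proof (cases "P_comp b = 0")
      case False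
      then have v: "extend b \<in> extended_compositions (Suc n)" using b extended_compositions by simp
      then have "word_kernel (extend b) 1 1 * fact n \<le> word_kernel (extend c) 1 1 * fact n"
        using c by (simp add: optimal_compositions_def)
      then have "real (P_comp b) \<le> real (P_comp c)"
        using c by (simp only: P(1)[OF b] P(1)[of c] P_set_eq_word_kernel[OF v] P_set_eq_word_kernel[OF w])
      then show ?thesis by simp
    qed simp
    with c show "c \<in> maximal_compositions n"
      by (auto simp: maximal_compositions_def maximal_composition_def composition_def)
  qed
qed

lemma extend_inj: "extend c = extend d \<Longrightarrow> c = d"
  by (cases c rule: rev_cases; cases d rule: rev_cases) (auto simp: extend_snoc)

section \<open>Partial sums of the optimal words\<close>

lemma mem_partial_sums_threes:
  "w \<noteq> [] \<Longrightarrow> x \<in> partial_sums (replicate i 3 @ w)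
    \<longleftrightarrow> (\<exists>k. x = 3 * k \<and> 1 \<le> k \<and> k \<le> i) \<or> (\<exists>y\<in>partial_sums w. x = 3 * i + y)"
proof (induction i arbitrary: x)
  case (Suc i)
  have "x \<in> partial_sums (replicate (Suc i) 3 @ w)
      \<longleftrightarrow> x = 3 \<or> (\<exists>z\<in>partial_sums (replicate i 3 @ w). x = 3 + z)"
    using Suc.prems by (auto simp: partial_sums_Cons)
  also have "\<dots> \<longleftrightarrow> (x = 3 \<or> (\<exists>k. x = 3 + 3 * k \<and> 1 \<le> k \<and> k \<le> i)) \<or> (\<exists>y\<in>partial_sums w. x
    = 3 + (3 * i + y))"
    unfolding Bex_def Suc.IH[OF Suc.prems] by auto
  also have "x = 3 \<or> (\<exists>k. x = 3 + 3 * k \<and> 1 \<le> k \<and> k \<le> i) \<longleftrightarrow> (\<exists>k. x = 3 * k \<and> 1 \<le> k \<and> k \<le> Suc i)"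
    (is "?L \<longleftrightarrow> ?R")
  proof
    assume ?L
    then show ?R
    proof
      assume "\<exists>k. x = 3 + 3 * k \<and> 1 \<le> k \<and> k \<le> i"
      then obtain k where "x = 3 * Suc k" "k \<le> i" by auto
      then show ?R by (intro exI[of _ "Suc k"]) simp
    qed (intro exI[of _ 1], simp)
  next
    assume ?R
    then obtain k where k: "x = 3 * k" "1 \<le> k" "k \<le> Suc i" by blast
    then obtain k' where "k = Suc k'" by (metis Suc_le_D One_nat_def)
    with k show ?L by (cases "k' = 0") auto
  qed
  finally show ?case by (simp add: add.assoc)
qed simp

lemma mem_partial_sums_replicate:
  "1 \<le> m \<Longrightarrow> x \<in> partial_sums (replicate m 3) \<longleftrightarrow> (\<exists>k. x = 3 * k \<and> 1 \<le> k \<and> k < m)"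
  using mem_partial_sums_threes[of "[3]" x "m - 1"]
  by (cases m) (auto simp: replicate_append_same less_Suc_eq_le)

lemma mem_partial_sums_Cons_threes:
  assumes "1 \<le> m"
  shows "x \<in> partial_sums (a # replicate m 3) \<longleftrightarrow> (\<exists>k. x = a + 3 * k \<and> k < m)"
proof -
  have "replicate m (3 :: nat) \<noteq> []" using assms by simp
  then have "x \<in> partial_sums (a # replicate m 3) \<longleftrightarrow> x = a \<or> (\<exists>z\<in>partial_sums (replicate m 3). x = a + z)"
    by (auto simp: partial_sums_Cons)
  also have "\<dots> \<longleftrightarrow> x = a \<or> (\<exists>k. x = a + 3 * k \<and> 1 \<le> k \<and> k < m)"
    unfolding Bex_def mem_partial_sums_replicate[OF assms] by auto
  also have "\<dots> \<longleftrightarrow> (\<exists>k. x = a + 3 * k \<and> k < m)"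
    using assms by (auto simp: Suc_le_eq)
  finally show ?thesis .
qed

lemma partial_sums_threes:
  assumes "1 \<le> m" "3 * m - 3 \<le> n" "n < 3 * m"
  shows "partial_sums (replicate m 3) = {3 * k | k. 1 \<le> k} \<inter> {1..n}"
  using assms by (auto simp: mem_partial_sums_replicate)

lemma partial_sums_threes_4:
  assumes "1 \<le> m"
  shows "partial_sums (replicate m 3 @ [4]) = {3 * k | k. 1 \<le> k} \<inter> {1..3 * m + 2}"
  using assms by (auto simp: mem_partial_sums_threes)

lemma partial_sums_4_threes:
  assumes "1 \<le> m"
  shows "partial_sums (4 # replicate m 3) = {3 * k + 1 | k. 1 \<le> k} \<inter> {1..3 * m + 2}"
proof (intro equalityI subsetI)
  fix x assume "x \<in> partial_sums (4 # replicate m 3)"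
  then obtain k where "x = 3 * Suc k + 1" "k < m" by (auto simp: mem_partial_sums_Cons_threes[OF assms])
  then have "x = 3 * Suc k + 1" "1 \<le> Suc k" "x \<in> {1..3 * m + 2}" by auto
  then show "x \<in> {3 * k + 1 | k. 1 \<le> k} \<inter> {1..3 * m + 2}" by blast
next
  fix x assume "x \<in> {3 * k + 1 | k. 1 \<le> k} \<inter> {1..3 * m + 2}"
  then obtain k where k: "x = 3 * k + 1" "1 \<le> k" "x \<le> 3 * m + 2" by auto
  then obtain k' where "k = Suc k'" by (metis Suc_le_D One_nat_def)
  with k show "x \<in> partial_sums (4 # replicate m 3)"
    by (simp add: mem_partial_sums_Cons_threes[OF assms])
qed

lemma partial_sums_threes_2_threes:
  assumes "1 \<le> j"
  shows "partial_sums (replicate i 3 @ 2 # replicate j 3)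
    = ({3 * k | k. 1 \<le> k \<and> k \<le> i} \<union> {3 * i + 2 + 3 * k | k. 0 \<le> k}) \<inter> {1..3 * (i + j)}"
proof -
  have "x \<in> partial_sums (replicate i 3 @ 2 # replicate j 3)
      \<longleftrightarrow> (\<exists>k. x = 3 * k \<and> 1 \<le> k \<and> k \<le> i) \<or> (\<exists>k. x = 3 * i + (2 + 3 * k) \<and> k < j)" for x
    using mem_partial_sums_threes[of "2 # replicate j 3" x i]
    by (auto simp: mem_partial_sums_Cons_threes[OF assms])
  then show ?thesis by auto
qed

section \<open>Maximal compositions and peak sets by residue\<close>

lemma maximal_compositions_image:
  assumes "1 \<le> n" "optimal_compositions (Suc n) = extend ` C" "C \<subseteq> {c. composition n c}"
  shows "maximal_compositions n = C"
  using assms(3) by (auto simp: maximal_compositions_eq[OF assms(1)] assms(2) dest: extend_inj)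

text \<open>Size \<open>3 * l\<close> corresponds to extended size \<open>3 * l + 1\<close>. The two
  optimal words mirror each other, a 4 at the end or at the start; lowering the last part by 1 hides
  the symmetry.\<close>

lemma maximal_compositions_mod_0:
  assumes "2 \<le> l"
  shows "maximal_compositions (3 * l) = {replicate l 3, [4] @ replicate (l - 2) 3 @ [2]}"
proof (rule maximal_compositions_image)
  obtain q where q: "l = Suc (Suc q)" using assms by (metis add_2_eq_Suc less_eqE)
  have "extend (replicate l 3) = replicate (l - 1) 3 @ [4]"
    using extend_snoc[of "replicate (Suc q) 3" 3] by (simp add: q replicate_append_same)
  moreover have "extend ([4] @ replicate (l - 2) 3 @ [2]) = 4 # replicate (l - 1) 3"
    using extend_snoc[of "4 # replicate q 3" 2] by (simp add: q replicate_append_same)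
  ultimately show "optimal_compositions (Suc (3 * l)) = extend ` {replicate l 3, [4] @ replicate (l
    - 2) 3 @ [2]}"
    using optimal_compositions_mod_1[OF assms] by auto
qed (use assms in \<open>auto simp: composition_def sum_list_replicate\<close>)

lemma maximal_compositions_mod_1:
  assumes "2 \<le> l"
  shows "maximal_compositions (3 * l + 1) =
    {replicate s 3 @ [2] @ replicate t 3 @ [2] | s t. 1 \<le> s \<and> 0 \<le> t \<and> s + t = l - 1}" (is "_ = ?C")
proof (rule maximal_compositions_image)
  have ext: "extend (replicate s 3 @ [2] @ replicate t 3 @ [2])
    = replicate s 3 @ 2 # replicate (Suc t) 3" for s t
    using extend_snoc[of "replicate s 3 @ [2] @ replicate t 3" 2] by (simp add: replicate_append_same)
  have "optimal_compositions (Suc (3 * l + 1))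
    = {replicate i 3 @ 2 # replicate j 3 | i j. 1 \<le> i \<and> 1 \<le> j \<and> i + j = l}"
    using optimal_compositions_mod_2[OF assms] by simp
  also have "\<dots> = extend ` ?C"
  proof (intro equalityI subsetI)
    fix w :: "nat list" assume "w \<in> {replicate i 3 @ 2 # replicate j 3 | i j. 1 \<le> i \<and> 1 \<le> j \<and> i + j = l}"
    then obtain i j where w: "w = replicate i 3 @ 2 # replicate j 3" "1 \<le> i" "1 \<le> j" "i + j = l" by blast
    then obtain t where "j = Suc t" by (metis Suc_le_D One_nat_def)
    with w have "w = extend (replicate i 3 @ [2] @ replicate t 3 @ [2])" "i + t = l - 1"
      unfolding ext by auto
    with w(2) show "w \<in> extend ` ?C" by blast
  next
    fix w assume "w \<in> extend ` ?C"
    then obtain s t where "w = extend (replicate s 3 @ [2] @ replicate t 3 @ [2])" "1 \<le> s" "s + t = l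
      - 1" by blast
    then have "w = replicate s 3 @ 2 # replicate (Suc t) 3" "1 \<le> s" "1 \<le> Suc t" "s + Suc t = l"
      unfolding ext using assms by auto
    then show "w \<in> {replicate i 3 @ 2 # replicate j 3 | i j. 1 \<le> i \<and> 1 \<le> j \<and> i + j = l}" by blast
  qed
  finally show "optimal_compositions (Suc (3 * l + 1)) = extend ` ?C" .
qed (use assms in \<open>auto simp: composition_def sum_list_replicate\<close>)

lemma maximal_compositions_mod_2:
  assumes "2 \<le> l"
  shows "maximal_compositions (3 * l + 2) = {replicate l 3 @ [2]}"
proof (rule maximal_compositions_image)
  have "extend (replicate l 3 @ [2]) = replicate (Suc l) 3"
    using extend_snoc[of "replicate l 3" 2] by (simp add: replicate_append_same)
  moreover have "Suc (3 * l + 2) = 3 * Suc l" "3 \<le> Suc l" using assms by auto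
  ultimately show "optimal_compositions (Suc (3 * l + 2)) = extend ` {replicate l 3 @ [2]}"
    by (simp only: optimal_compositions_mod_0 image_insert image_empty)
qed (auto simp: composition_def sum_list_replicate)

lemma maximal_peak_sets_mod_0:
  assumes "2 \<le> l"
  shows "maximal_peak_sets (3 * l) = {{3 * k | k. 1 \<le> k} \<inter> {1..3 * l
    - 1}, {3 * k + 1 | k. 1 \<le> k} \<inter> {1..3 * l - 1}}"
proof -
  have "3 * l - 1 = 3 * (l - 1) + 2" "1 \<le> l - 1" using assms by auto
  then show ?thesis
    using optimal_compositions_mod_1[OF assms] partial_sums_threes_4[of "l
      - 1"] partial_sums_4_threes[of "l - 1"]
      maximal_peak_sets_eq[of "3 * l"] assms by (simp only:) auto
qed

lemma maximal_peak_sets_mod_1: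
  assumes "2 \<le> l"
  shows "maximal_peak_sets (3 * l + 1) =
    {({3 * k | k. 1 \<le> k \<and> k \<le> s} \<union> {3 * s + 2 + 3 * k | k. 0 \<le> k}) \<inter> {1..3 * l}
      | s. 1 \<le> s \<and> s \<le> l - 1}" (is "_ = {?S s | s. _}")
proof -
  have "maximal_peak_sets (3 * l + 1)
      = {partial_sums (replicate i 3 @ 2 # replicate j 3) | i j. 1 \<le> i \<and> 1 \<le> j \<and> i + j = l}"
    using optimal_compositions_mod_2[OF assms] maximal_peak_sets_eq[of "3 * l + 1"] by auto
  also have "\<dots> = {?S s | s. 1 \<le> s \<and> s \<le> l - 1}"
  proof (intro equalityI subsetI)
    fix T assume "T \<in> {partial_sums (replicate i 3 @ 2 # replicate j 3) | i j. 1 \<le> i \<and> 1 \<le> j \<and> i + j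
      = l}"
    then obtain i j where ij: "T
      = partial_sums (replicate i 3 @ 2 # replicate j 3)" "1 \<le> i" "1 \<le> j" "i + j = l" by blast
    then have "T = ?S i" "i \<le> l - 1" using partial_sums_threes_2_threes[of j i] by auto
    with ij(2) show "T \<in> {?S s | s. 1 \<le> s \<and> s \<le> l - 1}" by blast
  next
    fix T assume "T \<in> {?S s | s. 1 \<le> s \<and> s \<le> l - 1}"
    then obtain s where s: "T = ?S s" "1 \<le> s" "s \<le> l - 1" by blast
    with assms have "1 \<le> l - s" "s + (l - s) = l" by auto
    moreover from this s have "T = partial_sums (replicate s 3 @ 2 # replicate (l - s) 3)"
      using partial_sums_threes_2_threes[of "l - s" s] by simp
    ultimately show "T \<in> {partial_sums (replicate i 3 @ 2 # replicate j 3) | i j. 1 \<le> i \<and> 1 \<le> j \<and> i + j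
      = l}"
      using s(2) by blast
  qed
  finally show ?thesis .
qed

lemma maximal_peak_sets_mod_2:
  assumes "2 \<le> l"
  shows "maximal_peak_sets (3 * l + 2) = {{3 * k | k. 1 \<le> k} \<inter> {1..3 * l + 1}}"
proof -
  have "optimal_compositions (Suc (3 * l + 2)) = {replicate (Suc l) 3}"
  proof -
    have "Suc (3 * l + 2) = 3 * Suc l" "3 \<le> Suc l" using assms by auto
    then show ?thesis by (simp only: optimal_compositions_mod_0)
  qed
  then show ?thesis
    using maximal_peak_sets_eq[of "3 * l + 2"] partial_sums_threes[of "Suc l" "3 * l + 1"]
    by (simp del: replicate_Suc)
qed

theorem theorem1p1:
  shows "(\<forall>l::nat. 2 \<le> l \<longrightarrow>
      maximal_compositions (3 * l) = {replicate l 3, [4] @ replicate (l - 2) 3 @ [2]} \<and>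
      maximal_compositions (3 * l + 1) =
        {replicate s 3 @ [2] @ replicate t 3 @ [2] | s t. 1 \<le> s \<and> 0 \<le> t \<and> s + t = l - 1} \<and>
      maximal_compositions (3 * l + 2) = {replicate l 3 @ [2]}) \<and>
    (\<forall>n::nat. 6 \<le> n \<longrightarrow>
      (n mod 3 = 0 \<longrightarrow> maximal_peak_sets n =
        {{3 * k | k. 1 \<le> k} \<inter> {1..n - 1}, {3 * k + 1 | k. 1 \<le> k} \<inter> {1..n - 1}}) \<and>
      (n mod 3 = 1 \<longrightarrow> maximal_peak_sets n =
        {({3 * k | k. 1 \<le> k \<and> k \<le> s} \<union> {3 * s + 2 + 3 * k | k. 0 \<le> k}) \<inter> {1..n - 1}
          | s. 1 \<le> s \<and> s \<le> n div 3 - 1}) \<and>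
      (n mod 3 = 2 \<longrightarrow> maximal_peak_sets n = {{3 * k | k. 1 \<le> k} \<inter> {1..n - 1}}))"
proof (intro conjI allI impI)
  fix n :: nat assume n: "6 \<le> n"
  define l where "l = n div 3"
  have l: "2 \<le> l" using n by (simp add: l_def)
  {
    assume "n mod 3 = 0"
    then have "n = 3 * l" unfolding l_def by presburger
    then show "maximal_peak_sets n =
        {{3 * k | k. 1 \<le> k} \<inter> {1..n - 1}, {3 * k + 1 | k. 1 \<le> k} \<inter> {1..n - 1}}"
      using maximal_peak_sets_mod_0[OF l] by simp
  next
    assume "n mod 3 = 1"
    then have n_eq: "n = 3 * l + 1" unfolding l_def by presburger
    then have "n - 1 = 3 * l" by simp
    then show "maximal_peak_sets n =
        {({3 * k | k. 1 \<le> k \<and> k \<le> s} \<union> {3 * s + 2 + 3 * k | k. 0 \<le> k}) \<inter> {1..n - 1}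
          | s. 1 \<le> s \<and> s \<le> n div 3 - 1}"
      unfolding l_def[symmetric] \<open>n - 1 = 3 * l\<close>
      using maximal_peak_sets_mod_1[OF l] by (simp only: n_eq)
  next
    assume "n mod 3 = 2"
    then have "n = 3 * l + 2" unfolding l_def by presburger
    then show "maximal_peak_sets n = {{3 * k | k. 1 \<le> k} \<inter> {1..n - 1}}"
      using maximal_peak_sets_mod_2[OF l] by simp
  }
qed (rule maximal_compositions_mod_0 maximal_compositions_mod_1 maximal_compositions_mod_2; assumption)+

end
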